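(* Let $r>0$ and $1<p<\infty$. Let $w,\sigma$ be a pair of weights on $\mathbb R^n$ and let $\mathcal S$ be a sparse collection of dyadic cubes. Define $$\mathcal T=\sup_{R\in\mathcal S}\sigma(R)^{-\frac rp}\Big\|\sum_{\substack{Q\in\mathcal S\\ Q\subset R}}\langle\sigma\rangle_Q^r\,\mathbf 1_Q\Big\|_{L^{\frac pr}(w)}$$ and, when $p>r$, with $(\frac pr)'=\frac{p}{p-r}$, $$\mathcal T^*=\sup_{R\in\mathcal S}w(R)^{-\frac1{(p/r)'}}\Big\|\sum_{\substack{Q\in\mathcal S\\ Q\subset R}}\langle\sigma\rangle_Q^{r-1}\langle w\rangle_Q\,\mathbf 1_Q\Big\|_{L^{(p/r)'}(\sigma)}.$$ Then $$\mathcal T\lesssim[w,\sigma]_{A_p}^{\frac rp}\,[\sigma]_{A_\infty}^{\frac rp},$$ and $$\mathcal T^*\lesssim[w,\sigma]_{A_p}^{\frac rp}\,[w]_{A_\infty}^{1-\frac rp}\qquad\text{if }p>r.$$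
   Context: Work in $\mathbb R^n$ with a fixed system $\mathcal D$ of dyadic cubes. A weight is a locally integrable, a.e. positive function; $w(E)=\int_E w\,dx$, and $\|g\|_{L^q(w)}=(\int|g|^q w\,dx)^{1/q}$ (also for $0<q<1$). For a cube $Q$, $\langle f\rangle_Q:=\frac1{|Q|}\int_Q f\,dx$. A collection $\mathcal S\subset\mathcal D$ is sparse if there are pairwise disjoint subsets $E(S)\subset S$, $S\in\mathcal S$, with $|E(S)|\ge\frac12|S|$. The (dyadic) weight characteristics are $$[w,\sigma]_{A_p}:=\sup_{Q\in\mathcal D}\langle w\rangle_Q\langle\sigma\rangle_Q^{p-1},\qquad [w]_{A_\infty}:=\sup_{Q\in\mathcal D}\frac1{w(Q)}\int_Q M(\mathbf 1_Q w)\,dx,$$ where $M f=\sup_{Q\in\mathcal D}\langle |f|\rangle_Q\mathbf 1_Q$ is the dyadic maximal operator. $X\lesssim Y$ means $X\le C\,Y$ with a constant $C$ independent of $w,\sigma,\mathcal S$. *)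

theory Defs
  imports "HOL-Analysis.Analysis"
begin

text \<open>
  All quantities are nonnegative, and several (the weight characteristics, the testing constants,
  the sums over a sparse collection) may be infinite, so they take values in \<^typ>\<open>ennreal\<close>.
  The library has no real powers on \<^typ>\<open>ennreal\<close>; the conventions at the end points are
  $0^a = \infty$ and $\infty^a = 0$ for $a < 0$, and $x^0 = 1$.
\<close>

definition epowr :: "ennreal \<Rightarrow> real \<Rightarrow> ennreal" where
  "epowr x a =
    (if a = 0 then 1
     else if x = 0 then (if a > 0 then 0 else \<infinity>)
     else if x = \<infinity> then (if a > 0 then \<infinity> else 0)
     else ennreal (enn2real x powr a))"

definition half_open_cube :: "real ^ 'n \<Rightarrow> real \<Rightarrow> (real ^ 'n) set" where
  "half_open_cube a l = {x. \<forall>i. a $ i \<le> x $ i \<and> x $ i < a $ i + l}"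

text \<open>
  This covers the standard system, consisting of the cubes $2^{-k}([0,1)^n + m)$ for integers $k$
  and integer vectors $m$, as well as its translated variants.
\<close>

definition dyadic_system :: "(real ^ 'n) set set \<Rightarrow> bool" where
  "dyadic_system \<D> \<longleftrightarrow>
    (\<exists>G :: int \<Rightarrow> (real ^ 'n) set set.
        \<D> = (\<Union>k. G k) \<and>
        (\<forall>k. partition_on UNIV (G k)) \<and>
        (\<forall>k. \<forall>Q \<in> G k. \<exists>a. Q = half_open_cube a (2 powi (- k))) \<and>
        (\<forall>k. \<forall>Q \<in> G (k + 1). \<exists>P \<in> G k. Q \<subseteq> P))"

definition weight :: "(real ^ 'n \<Rightarrow> real) \<Rightarrow> bool" where
  "weight w \<longleftrightarrow>
    (\<forall>K. compact K \<longrightarrow> w absolutely_integrable_on K) \<and> (AE x in lebesgue. w x > 0)"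

definition wmass :: "(real ^ 'n \<Rightarrow> real) \<Rightarrow> (real ^ 'n) set \<Rightarrow> ennreal" where
  "wmass w E = (\<integral>\<^sup>+x\<in>E. ennreal (w x) \<partial>lebesgue)"

definition wnorm :: "(real ^ 'n \<Rightarrow> real) \<Rightarrow> real \<Rightarrow> (real ^ 'n \<Rightarrow> ennreal) \<Rightarrow> ennreal" where
  "wnorm w q g = epowr (\<integral>\<^sup>+x. epowr (g x) q * ennreal (w x) \<partial>lebesgue) (1 / q)"

text \<open>The average is only meant for functions that are nonnegative almost everywhere:
  negative values are truncated to 0.\<close>

definition avg :: "(real ^ 'n \<Rightarrow> real) \<Rightarrow> (real ^ 'n) set \<Rightarrow> ennreal" where
  "avg f Q = (\<integral>\<^sup>+x\<in>Q. ennreal (f x) \<partial>lebesgue) / emeasure lebesgue Q"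

definition dyadic_maximal ::
    "(real ^ 'n) set set \<Rightarrow> (real ^ 'n \<Rightarrow> real) \<Rightarrow> real ^ 'n \<Rightarrow> ennreal" where
  "dyadic_maximal \<D> f x = (SUP Q\<in>\<D>. avg (\<lambda>y. \<bar>f y\<bar>) Q * indicator Q x)"

definition sparse_family :: "(real ^ 'n) set set \<Rightarrow> (real ^ 'n) set set \<Rightarrow> bool" where
  "sparse_family \<D> \<S> \<longleftrightarrow>
    \<S> \<subseteq> \<D> \<and>
    (\<exists>E :: (real ^ 'n) set \<Rightarrow> (real ^ 'n) set.
        disjoint_family_on E \<S> \<and>
        (\<forall>Q \<in> \<S>. E Q \<in> sets lebesgue \<and> E Q \<subseteq> Q \<and>
                measure lebesgue (E Q) \<ge> 1 / 2 * measure lebesgue Q))"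

definition Ap_char ::
    "(real ^ 'n) set set \<Rightarrow> real \<Rightarrow> (real ^ 'n \<Rightarrow> real) \<Rightarrow> (real ^ 'n \<Rightarrow> real) \<Rightarrow> ennreal" where
  "Ap_char \<D> p w \<sigma> = (SUP Q\<in>\<D>. avg w Q * epowr (avg \<sigma> Q) (p - 1))"

definition Ainf_char :: "(real ^ 'n) set set \<Rightarrow> (real ^ 'n \<Rightarrow> real) \<Rightarrow> ennreal" where
  "Ainf_char \<D> w =
    (SUP Q\<in>\<D>. (\<integral>\<^sup>+x\<in>Q. dyadic_maximal \<D> (\<lambda>y. indicator Q y * w y) x \<partial>lebesgue) / wmass w Q)"

text \<open>The sums below run over possibly infinite (countable) families; every such sum exists in
  \<^typ>\<open>ennreal\<close>.\<close>

definition testing_T ::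
    "real \<Rightarrow> real \<Rightarrow> (real ^ 'n \<Rightarrow> real) \<Rightarrow> (real ^ 'n \<Rightarrow> real) \<Rightarrow> (real ^ 'n) set set \<Rightarrow> ennreal" where
  "testing_T r p w \<sigma> \<S> =
    (SUP R\<in>\<S>. epowr (wmass \<sigma> R) (- (r / p)) *
       wnorm w (p / r)
         (\<lambda>x. \<Sum>\<^sub>\<infinity>Q\<in>{Q \<in> \<S>. Q \<subseteq> R}. epowr (avg \<sigma> Q) r * indicator Q x))"

text \<open>Only meaningful for \<open>r < p\<close>, where \<open>p / (p - r)\<close> is the conjugate exponent of \<open>p / r\<close>.\<close>

definition testing_T_dual ::
    "real \<Rightarrow> real \<Rightarrow> (real ^ 'n \<Rightarrow> real) \<Rightarrow> (real ^ 'n \<Rightarrow> real) \<Rightarrow> (real ^ 'n) set set \<Rightarrow> ennreal" where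
  "testing_T_dual r p w \<sigma> \<S> =
    (SUP R\<in>\<S>. epowr (wmass w R) (- (1 / (p / (p - r)))) *
       wnorm \<sigma> (p / (p - r))
         (\<lambda>x. \<Sum>\<^sub>\<infinity>Q\<in>{Q \<in> \<S>. Q \<subseteq> R}. epowr (avg \<sigma> Q) (r - 1) * avg w Q * indicator Q x))"

end

theory Submission
  imports Defs
begin

text \<open>
  Write \<open>x\<close> and \<open>y\<close> for the averages of \<open>\<sigma>\<close> and \<open>w\<close> over a cube \<open>Q\<close>, so that
  \<open>y * x powr (p - 1) \<le> K\<close> with \<open>K\<close> the joint \<open>A\<^sub>p\<close> characteristic. In both testing constants the
  power of the norm of a sum of coefficients \<open>x powr u * y powr v\<close> over the cubes inside \<open>R\<close> has to
  be estimated, and in both cases it is enough to arrive at a power of \<open>K\<close> times the sum of the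
  masses \<open>\<sigma>(Q)\<close>, respectively \<open>w(Q)\<close>, over these cubes: sparseness compares that sum with the integral
  of the localised maximal function, which the \<open>A\<^sub>\<infinity>\<close> characteristic controls by the mass of \<open>R\<close>
  (\<open>sum_measure_le_Ainf_char\<close>).

  If the exponent of the norm is at most 1, the power is subadditive and the \<open>A\<^sub>p\<close> bound applies to
  each term. For an exponent \<open>s > 1\<close>, the cubes through a point form a chain, and summation by
  parts along it (\<open>powr_sum_chain_le\<close>) gives
  \[ \Bigl(\sum_Q a_Q 1_Q\Bigr)^s \le s \sum_Q a_Q 1_Q \Bigl(\sum_{P \subseteq Q} a_P 1_P\Bigr)^{s-1}. \]
  It remains to bound the integrals of the inner powers, which are local to \<open>Q\<close>; this is done by
  the same inequality, inductively in steps of one down to an exponent in \<open>(0,1]\<close>. At each stage a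
  sum over the subcubes of \<open>Q\<close> of products \<open>x powr a * y powr b\<close> times the volume appears, and
  Kolmogorov's inequality bounds it by its value at \<open>Q\<close>, provided that \<open>a, b \<ge> 0\<close> and \<open>a + b < 1\<close>
  (\<open>sum_mean_powr_mult_mean_powr_le\<close>). The sum \<open>a + b\<close> is brought below 1 by spending a power of
  the \<open>A\<^sub>p\<close> bound slightly larger than the homogeneous one, and the total amount of \<open>K\<close> spent is
  still right at the end, because the outermost sum is not collapsed in this way and the
  remaining power of the \<open>A\<^sub>p\<close> bound can be used there. This is \<open>nn_integral_mean_powr_sum_le\<close>; the two
  statements are two choices of its exponents.

  All estimates are proved for finite families with constants that depend on the exponents only,
  and are extended to the countable ones by monotone convergence. If one of the characteristics is
  infinite, there is nothing to show.
\<close>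

section \<open>Powers of sums over nested families\<close>

lemma powr_diff_le:
  fixes x y s :: real
  assumes "0 \<le> x" "x \<le> y" "1 \<le> s"
  shows "y powr s - x powr s \<le> s * y powr (s - 1) * (y - x)"
proof (cases "x = y \<or> x = 0")
  case True
  then show ?thesis
  proof
    assume x: "x = 0"
    have "y powr s = y powr (s - 1) * y"
      using assms powr_mult_base[of y "s - 1"] by (simp add: mult.commute)
    moreover have "y powr (s - 1) * y \<le> s * (y powr (s - 1) * y)"
      using assms mult_right_mono[of 1 s "y powr (s - 1) * y"] by simp
    ultimately show ?thesis using x by (simp add: mult.assoc)
  qed simp
next
  case False
  with assms have xy: "0 < x" "x < y" by auto
  obtain z where z: "x < z" "z < y" "y powr s - x powr s = (y - x) * (s * z powr (s - 1))"
    using MVT2[OF xy(2), of "\<lambda>t. t powr s" "\<lambda>t. s * t powr (s - 1)"] xy(1)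
      has_real_derivative_powr[of _ s] by (metis less_le_trans)
  have "z powr (s - 1) \<le> y powr (s - 1)"
    using z xy assms by (intro powr_mono2) auto
  then show ?thesis
    using z(3) xy assms by (simp add: mult.commute mult_left_mono)
qed

lemma powr_add_le_add_powr:
  fixes a b m :: real
  assumes "0 \<le> a" "0 \<le> b" "0 \<le> m" "m \<le> 1"
  shows "(a + b) powr m \<le> a powr m + b powr m"
proof (cases "a + b = 0")
  case False
  then have ab: "0 < a + b" using assms by linarith
  have frac: "t / (a + b) \<le> (t / (a + b)) powr m" if "0 \<le> t" "t \<le> a + b" for t
    using powr_mono'[of m 1 "t / (a + b)"] that ab assms by auto
  have "1 = a / (a + b) + b / (a + b)" using ab by (simp add: add_divide_distrib[symmetric])
  also have "\<dots> \<le> (a / (a + b)) powr m + (b / (a + b)) powr m"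
    using assms by (intro add_mono frac) auto
  also have "\<dots> = (a powr m + b powr m) / (a + b) powr m"
    by (simp add: powr_divide add_divide_distrib)
  finally show ?thesis using ab by (simp add: field_simps)
qed (use assms in auto)

lemma powr_sum_le_sum_powr:
  fixes a :: "'i \<Rightarrow> real"
  assumes "finite F" "\<And>i. i \<in> F \<Longrightarrow> 0 \<le> a i" "0 \<le> m" "m \<le> 1"
  shows "(\<Sum>i\<in>F. a i) powr m \<le> (\<Sum>i\<in>F. a i powr m)"
  using assms(1,2)
proof (induction F rule: finite_induct)
  case (insert i F)
  have "(\<Sum>i\<in>insert i F. a i) powr m \<le> a i powr m + (\<Sum>i\<in>F. a i) powr m"
    using insert assms(3,4) by (auto intro!: powr_add_le_add_powr sum_nonneg)
  with insert show ?case by fastforce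
qed simp

text \<open>
  For the partial sums \<open>T\<^sub>0 \<le> T\<^sub>1 \<le> \<dots>\<close> along the chain, listed from the smallest set upwards, the
  left-hand side telescopes into the increments \<open>T\<^sub>k powr s - T\<^sub>k\<^sub>-\<^sub>1 powr s\<close>, and each increment is
  controlled by the mean value theorem. The gain is that the exponent of the remaining sum, which
  only runs below \<open>Q\<close>, has dropped by one.
\<close>
lemma powr_sum_chain_le:
  fixes a :: "'a set \<Rightarrow> real"
  assumes "finite F" "\<And>P Q. P \<in> F \<Longrightarrow> Q \<in> F \<Longrightarrow> P \<subseteq> Q \<or> Q \<subseteq> P"
    and "\<And>Q. Q \<in> F \<Longrightarrow> 0 \<le> a Q" and s: "1 \<le> s"
  shows "(\<Sum>Q\<in>F. a Q) powr s \<le> s * (\<Sum>Q\<in>F. a Q * (\<Sum>P\<in>{P\<in>F. P \<subseteq> Q}. a P) powr (s - 1))"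
  using assms(1-3)
proof (induction F rule: finite_psubset_induct)
  case (psubset F)
  show ?case
  proof (cases "F = {}")
    case False
    obtain T where T: "T \<in> F" "\<And>Q. Q \<in> F \<Longrightarrow> T \<subseteq> Q \<Longrightarrow> Q = T"
      using finite_has_maximal[OF psubset.hyps False] by metis
    have top: "Q \<subseteq> T" if "Q \<in> F" for Q using psubset.prems(1)[OF that T(1)] T(2) that by auto
    let ?G = "F - {T}"
    let ?t = "\<lambda>F Q. (\<Sum>P\<in>{P\<in>F. P \<subseteq> Q}. a P)"
    have below: "{P\<in>F. P \<subseteq> Q} = {P\<in>?G. P \<subseteq> Q}" if "Q \<in> ?G" for Q using that T top by auto
    have all: "{P\<in>F. P \<subseteq> T} = F" using top by auto
    have IH: "(\<Sum>Q\<in>?G. a Q) powr s \<le> s * (\<Sum>Q\<in>?G. a Q * ?t ?G Q powr (s - 1))"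
      using psubset.prems T(1) by (intro psubset.IH) auto
    have sumF: "(\<Sum>Q\<in>F. f Q) = f T + (\<Sum>Q\<in>?G. f Q)" for f :: "'a set \<Rightarrow> real"
      using psubset.hyps T(1) by (simp add: sum.remove)
    have "(\<Sum>Q\<in>F. a Q) powr s - (\<Sum>Q\<in>?G. a Q) powr s
        \<le> s * (\<Sum>Q\<in>F. a Q) powr (s - 1) * ((\<Sum>Q\<in>F. a Q) - (\<Sum>Q\<in>?G. a Q))"
      using psubset.prems(2) psubset.hyps s T(1)
      by (intro powr_diff_le sum_mono2 sum_nonneg) auto
    also have "\<dots> = s * (a T * (\<Sum>Q\<in>F. a Q) powr (s - 1))" by (simp add: sumF[of a])
    finally have "(\<Sum>Q\<in>F. a Q) powr s
        \<le> s * (a T * (\<Sum>Q\<in>F. a Q) powr (s - 1)) + s * (\<Sum>Q\<in>?G. a Q * ?t ?G Q powr (s - 1))"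
      using IH by linarith
    also have "(\<Sum>Q\<in>?G. a Q * ?t ?G Q powr (s - 1)) = (\<Sum>Q\<in>?G. a Q * ?t F Q powr (s - 1))"
      using below by (intro sum.cong) auto
    also have "s * (a T * (\<Sum>Q\<in>F. a Q) powr (s - 1)) + s * (\<Sum>Q\<in>?G. a Q * ?t F Q powr (s - 1))
        = s * (\<Sum>Q\<in>F. a Q * ?t F Q powr (s - 1))"
      by (subst (2) sumF) (simp add: all distrib_left)
    finally show ?thesis .
  qed simp
qed

section \<open>Integrals of powers of sums\<close>

abbreviation step_sum :: "('a set \<Rightarrow> real) \<Rightarrow> 'a set set \<Rightarrow> 'a \<Rightarrow> real" where
  "step_sum a F x \<equiv> (\<Sum>Q\<in>F. a Q * indicator Q x)"

lemma nn_integral_step_sum_powr_le_one: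
  fixes a :: "'a set \<Rightarrow> real"
  assumes "finite F" "F \<subseteq> sets M" "\<And>Q. Q \<in> F \<Longrightarrow> 0 \<le> a Q" "0 < m" "m \<le> 1"
  shows "(\<integral>\<^sup>+x. ennreal (step_sum a F x powr m) \<partial>M) \<le> (\<Sum>Q\<in>F. ennreal (a Q powr m) * emeasure M Q)"
proof -
  have "step_sum a F x powr m \<le> (\<Sum>Q\<in>F. a Q powr m * indicator Q x)" for x
  proof -
    have "step_sum a F x powr m \<le> (\<Sum>Q\<in>F. (a Q * indicator Q x) powr m)"
      using assms by (intro powr_sum_le_sum_powr) auto
    also have "\<dots> = (\<Sum>Q\<in>F. a Q powr m * indicator Q x)"
      by (intro sum.cong) (auto simp: indicator_def)
    finally show ?thesis .
  qed
  then have "(\<integral>\<^sup>+x. ennreal (step_sum a F x powr m) \<partial>M)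
      \<le> (\<integral>\<^sup>+x. (\<Sum>Q\<in>F. ennreal (a Q powr m) * indicator Q x) \<partial>M)"
    by (intro nn_integral_mono)
      (simp add: ennreal_leI ennreal_indicator[symmetric] ennreal_mult'[symmetric] del: ennreal_indicator)
  also have "\<dots> = (\<Sum>Q\<in>F. ennreal (a Q powr m) * emeasure M Q)"
    using assms(2) by (subst nn_integral_sum) (auto simp: nn_integral_cmult_indicator subset_eq)
  finally show ?thesis .
qed

text \<open>
  The exponent of the inner sums, taken over the sets below \<open>Q\<close>, is smaller by one. Integrating the
  pointwise chain inequality thus turns a bound for the exponent \<open>s - 1\<close>, applied at every top set
  \<open>Q\<close>, into one for the exponent \<open>s\<close>.
\<close>
lemma nn_integral_step_sum_powr_step:
  fixes a :: "'a set \<Rightarrow> real"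
  assumes F: "finite F" "F \<subseteq> sets M"
    and nested: "\<And>P Q. P \<in> F \<Longrightarrow> Q \<in> F \<Longrightarrow> P \<subseteq> Q \<or> Q \<subseteq> P \<or> P \<inter> Q = {}"
    and a: "\<And>Q. Q \<in> F \<Longrightarrow> 0 \<le> a Q" and s: "1 \<le> s"
    and below: "\<And>Q. Q \<in> F \<Longrightarrow>
      (\<integral>\<^sup>+x. ennreal (step_sum a {P\<in>F. P \<subseteq> Q} x powr (s - 1)) \<partial>M) \<le> ennreal (\<Psi> Q)"
    and \<Psi>: "\<And>Q. Q \<in> F \<Longrightarrow> 0 \<le> \<Psi> Q"
  shows "(\<integral>\<^sup>+x. ennreal (step_sum a F x powr s) \<partial>M) \<le> ennreal (s * (\<Sum>Q\<in>F. a Q * \<Psi> Q))"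
proof -
  let ?t = "\<lambda>Q x. step_sum a {P\<in>F. P \<subseteq> Q} x"
  have pw: "step_sum a F x powr s \<le> s * (\<Sum>Q\<in>F. a Q * ?t Q x powr (s - 1))" for x
  proof -
    let ?F = "{Q\<in>F. x \<in> Q}"
    have restrict: "step_sum a G x = (\<Sum>Q\<in>{Q\<in>G. x \<in> Q}. a Q)" if "finite G" for G
      using that by (intro sum.mono_neutral_cong_right) auto
    have "step_sum a F x powr s
        \<le> s * (\<Sum>Q\<in>?F. a Q * (\<Sum>P\<in>{P\<in>?F. P \<subseteq> Q}. a P) powr (s - 1))"
      unfolding restrict[OF F(1)] using F(1) nested a s by (intro powr_sum_chain_le) auto
    also have "\<dots> = s * (\<Sum>Q\<in>?F. a Q * ?t Q x powr (s - 1))"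
      using F(1) by (subst restrict) (auto intro!: sum.cong arg_cong2[where f = "(powr)"])
    also have "\<dots> \<le> s * (\<Sum>Q\<in>F. a Q * ?t Q x powr (s - 1))"
      using F(1) s a by (intro mult_left_mono sum_mono2) auto
    finally show ?thesis .
  qed
  have meas: "(\<lambda>x. ennreal (?t Q x powr (s - 1))) \<in> borel_measurable M" for Q
  proof -
    have [measurable]: "P \<in> sets M" if "P \<in> {P \<in> F. P \<subseteq> Q}" for P using that F(2) by auto
    show ?thesis by measurable
  qed
  have "(\<integral>\<^sup>+x. ennreal (step_sum a F x powr s) \<partial>M)
      \<le> (\<integral>\<^sup>+x. (\<Sum>Q\<in>F. ennreal (s * a Q) * ennreal (?t Q x powr (s - 1))) \<partial>M)"
  proof (rule nn_integral_mono)
    fix x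
    have "ennreal (step_sum a F x powr s) \<le> ennreal (\<Sum>Q\<in>F. s * a Q * ?t Q x powr (s - 1))"
      using pw[of x] by (intro ennreal_leI) (simp add: sum_distrib_left mult.assoc)
    also have "\<dots> = (\<Sum>Q\<in>F. ennreal (s * a Q) * ennreal (?t Q x powr (s - 1)))"
      using s a by (subst sum_ennreal[symmetric]) (auto simp: ennreal_mult)
    finally show "ennreal (step_sum a F x powr s)
        \<le> (\<Sum>Q\<in>F. ennreal (s * a Q) * ennreal (?t Q x powr (s - 1)))" .
  qed
  also have "\<dots> = (\<Sum>Q\<in>F. ennreal (s * a Q) * (\<integral>\<^sup>+x. ennreal (?t Q x powr (s - 1)) \<partial>M))"
    using meas by (subst nn_integral_sum) (auto simp: nn_integral_cmult)
  also have "\<dots> \<le> (\<Sum>Q\<in>F. ennreal (s * a Q) * ennreal (\<Psi> Q))"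
    using below by (intro sum_mono mult_left_mono) auto
  also have "\<dots> = ennreal (s * (\<Sum>Q\<in>F. a Q * \<Psi> Q))"
    using s a \<Psi>
    by (subst sum_distrib_left) (simp add: ennreal_mult[symmetric] mult.assoc)
  finally show ?thesis .
qed

text \<open>
  The previous step is iterated from an exponent \<open>m \<le> 1\<close>, where the power is subadditive, up to
  \<open>m + n\<close>. The function \<open>\<Phi> j\<close> stands for the desired local bound with the exponent \<open>m + j\<close>: multiplying
  by the coefficient leads from \<open>\<Phi> j\<close> to \<open>\<Phi> (j + 1)\<close>, and the Carleson condition collapses the sum
  over all top sets to the single value at \<open>R\<close>.
\<close>
lemma nn_integral_step_sum_powr_iterate:
  fixes a :: "'a set \<Rightarrow> real" and \<Phi> :: "nat \<Rightarrow> 'a set \<Rightarrow> real"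
  assumes \<S>: "\<S> \<subseteq> sets M"
    and nested: "\<And>P Q. P \<in> \<S> \<Longrightarrow> Q \<in> \<S> \<Longrightarrow> P \<subseteq> Q \<or> Q \<subseteq> P \<or> P \<inter> Q = {}"
    and a: "\<And>Q. Q \<in> \<S> \<Longrightarrow> 0 \<le> a Q" and \<Phi>: "\<And>j Q. Q \<in> \<S> \<Longrightarrow> 0 \<le> \<Phi> j Q"
    and m: "0 < m" "m \<le> 1" and c: "0 \<le> c"
    and base: "\<And>Q. Q \<in> \<S> \<Longrightarrow> ennreal (a Q powr m) * emeasure M Q \<le> ennreal (\<Phi> 0 Q)"
    and step: "\<And>j Q. j < n \<Longrightarrow> Q \<in> \<S> \<Longrightarrow> a Q * \<Phi> j Q \<le> \<Phi> (Suc j) Q"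
    and carleson: "\<And>j F R. j \<le> n \<Longrightarrow> finite F \<Longrightarrow> F \<subseteq> \<S> \<Longrightarrow> R \<in> \<S> \<Longrightarrow> (\<And>Q. Q \<in> F \<Longrightarrow> Q \<subseteq> R)
        \<Longrightarrow> (\<Sum>Q\<in>F. \<Phi> j Q) \<le> c * \<Phi> j R"
    and j: "j \<le> n" and F: "finite F" "F \<subseteq> \<S>" "R \<in> \<S>" "\<And>Q. Q \<in> F \<Longrightarrow> Q \<subseteq> R"
  shows "(\<integral>\<^sup>+x. ennreal (step_sum a F x powr (m + j)) \<partial>M)
      \<le> ennreal (c * (\<Prod>i=1..j. c * (m + real i)) * \<Phi> j R)"
  using j F
proof (induction j arbitrary: F R)
  case 0
  have "(\<integral>\<^sup>+x. ennreal (step_sum a F x powr m) \<partial>M)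
      \<le> (\<Sum>Q\<in>F. ennreal (a Q powr m) * emeasure M Q)"
    using 0 \<S> a m by (intro nn_integral_step_sum_powr_le_one) auto
  also have "\<dots> \<le> (\<Sum>Q\<in>F. ennreal (\<Phi> 0 Q))"
    using 0 base by (intro sum_mono) auto
  also have "\<dots> = ennreal (\<Sum>Q\<in>F. \<Phi> 0 Q)"
    using 0 \<Phi> by (intro sum_ennreal) auto
  also have "\<dots> \<le> ennreal (c * \<Phi> 0 R)"
    using 0 by (intro ennreal_leI carleson) auto
  finally show ?case by simp
next
  case (Suc j)
  let ?C = "c * (\<Prod>i=1..j. c * (m + real i))"
  have C: "0 \<le> ?C" using c m by (intro mult_nonneg_nonneg prod_nonneg) auto
  have "(\<integral>\<^sup>+x. ennreal (step_sum a F x powr (m + Suc j)) \<partial>M)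
      \<le> ennreal ((m + Suc j) * (\<Sum>Q\<in>F. a Q * (?C * \<Phi> j Q)))"
  proof (rule nn_integral_step_sum_powr_step)
    fix Q assume Q: "Q \<in> F"
    have "(\<integral>\<^sup>+x. ennreal (step_sum a {P \<in> F. P \<subseteq> Q} x powr (m + j)) \<partial>M)
        \<le> ennreal (?C * \<Phi> j Q)"
      using Suc.prems Q by (intro Suc.IH) auto
    then show "(\<integral>\<^sup>+x. ennreal (step_sum a {P \<in> F. P \<subseteq> Q} x powr (m + real (Suc j) - 1)) \<partial>M)
        \<le> ennreal (?C * \<Phi> j Q)"
      by simp
  next
    fix Q assume "Q \<in> F"
    then show "0 \<le> ?C * \<Phi> j Q" using Suc.prems \<Phi> by (intro mult_nonneg_nonneg[OF C]) auto
  next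
    fix P Q assume "P \<in> F" "Q \<in> F"
    then show "P \<subseteq> Q \<or> Q \<subseteq> P \<or> P \<inter> Q = {}" using Suc.prems(3) by (intro nested) auto
  qed (use Suc.prems \<S> a m in auto)
  also have "\<dots> \<le> ennreal (c * (\<Prod>i=1..Suc j. c * (m + real i)) * \<Phi> (Suc j) R)"
  proof (rule ennreal_leI)
    have "(\<Sum>Q\<in>F. a Q * (?C * \<Phi> j Q)) = ?C * (\<Sum>Q\<in>F. a Q * \<Phi> j Q)"
      unfolding sum_distrib_left by (intro sum.cong) (simp_all only: mult_ac)
    also have "\<dots> \<le> ?C * (\<Sum>Q\<in>F. \<Phi> (Suc j) Q)"
      using Suc.prems step C by (intro mult_left_mono sum_mono) auto
    also have "\<dots> \<le> ?C * (c * \<Phi> (Suc j) R)"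
      using Suc.prems C by (intro mult_left_mono carleson) auto
    finally have "(m + Suc j) * (\<Sum>Q\<in>F. a Q * (?C * \<Phi> j Q))
        \<le> (m + Suc j) * (?C * (c * \<Phi> (Suc j) R))"
      using m by (intro mult_left_mono) auto
    also have "\<dots> = c * (\<Prod>i=1..Suc j. c * (m + real i)) * \<Phi> (Suc j) R"
      by (simp add: algebra_simps)
    finally show "(m + Suc j) * (\<Sum>Q\<in>F. a Q * (?C * \<Phi> j Q))
        \<le> c * (\<Prod>i=1..Suc j. c * (m + real i)) * \<Phi> (Suc j) R" .
  qed
  finally show ?case .
qed

section \<open>Packing estimates for sparse families\<close>

text \<open>
  Only nestedness, sparseness and finiteness of the measures of dyadic cubes enter the packing
  arguments, so they are carried out for families of sets in an arbitrary measure space.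
\<close>
locale nested_sparse =
  fixes M :: "'a measure" and \<S> :: "'a set set" and E :: "'a set \<Rightarrow> 'a set"
  assumes sets: "\<And>Q. Q \<in> \<S> \<Longrightarrow> Q \<in> sets M"
    and pos: "\<And>Q. Q \<in> \<S> \<Longrightarrow> 0 < measure M Q"
    and fin: "\<And>Q. Q \<in> \<S> \<Longrightarrow> emeasure M Q < \<infinity>"
    and nested: "\<And>P Q. P \<in> \<S> \<Longrightarrow> Q \<in> \<S> \<Longrightarrow> P \<subseteq> Q \<or> Q \<subseteq> P \<or> P \<inter> Q = {}"
    and disjoint_E: "disjoint_family_on E \<S>"
    and sets_E: "\<And>Q. Q \<in> \<S> \<Longrightarrow> E Q \<in> sets M"
    and E_subset: "\<And>Q. Q \<in> \<S> \<Longrightarrow> E Q \<subseteq> Q"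
    and large_E: "\<And>Q. Q \<in> \<S> \<Longrightarrow> measure M Q \<le> 2 * measure M (E Q)"
begin

definition admissible :: "'a measure \<Rightarrow> bool" where
  "admissible N \<longleftrightarrow> sets N = sets M \<and>
    (\<forall>Q\<in>\<S>. 0 < emeasure N Q \<and> emeasure N Q < \<infinity>)"

definition mean :: "'a measure \<Rightarrow> 'a set \<Rightarrow> real" where
  "mean N Q = measure N Q / measure M Q"

lemma admissible_measure_pos: "admissible N \<Longrightarrow> Q \<in> \<S> \<Longrightarrow> 0 < measure N Q"
  unfolding admissible_def measure_def by (simp add: enn2real_positive_iff)

lemma mean_pos: "admissible N \<Longrightarrow> Q \<in> \<S> \<Longrightarrow> 0 < mean N Q"
  unfolding mean_def using admissible_measure_pos pos by simp

lemma admissible_fmeasurable: "admissible N \<Longrightarrow> Q \<in> \<S> \<Longrightarrow> Q \<in> fmeasurable N"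
  unfolding admissible_def fmeasurable_def using sets by auto

lemma fmeasurable: "Q \<in> \<S> \<Longrightarrow> Q \<in> fmeasurable M"
  unfolding fmeasurable_def using sets fin by auto

lemma mean_mult: "Q \<in> \<S> \<Longrightarrow> mean N Q * measure M Q = measure N Q"
  using pos[of Q] by (simp add: mean_def)

text \<open>The sets \<open>E Q\<close> are disjoint subsets of the union that carry at least half of each \<open>Q\<close>.\<close>
lemma sum_measure_le_Union:
  assumes "finite F" "F \<subseteq> \<S>"
  shows "(\<Sum>Q\<in>F. measure M Q) \<le> 2 * measure M (\<Union>F)"
proof -
  have fE: "E Q \<in> fmeasurable M" if "Q \<in> F" for Q
    using that assms fmeasurable sets_E E_subset fmeasurableI2 by (meson subsetD)
  have "(\<Sum>Q\<in>F. measure M Q) \<le> (\<Sum>Q\<in>F. 2 * measure M (E Q))"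
    using assms large_E by (intro sum_mono) auto
  also have "\<dots> = 2 * measure M (\<Union>Q\<in>F. E Q)"
    unfolding sum_distrib_left[symmetric]
    using assms fE disjoint_family_on_mono[OF assms(2) disjoint_E]
    by (subst measure_finite_Union) (auto simp: fmeasurable_def less_top[symmetric])
  also have "\<dots> \<le> 2 * measure M (\<Union>F)"
    using assms E_subset sets_E fmeasurable
    by (intro mult_left_mono measure_mono_fmeasurable)
      (auto simp: subset_eq intro!: sets.finite_UN fmeasurable.finite_Union)
  finally show ?thesis .
qed

lemma sum_measure_le:
  assumes "finite F" "F \<subseteq> \<S>" "R \<in> \<S>" "\<And>Q. Q \<in> F \<Longrightarrow> Q \<subseteq> R"
  shows "(\<Sum>Q\<in>F. measure M Q) \<le> 2 * measure M R"
proof -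
  have "measure M (\<Union>F) \<le> measure M R"
    using assms sets fmeasurable by (intro measure_mono_fmeasurable) (auto intro!: sets.finite_Union)
  with sum_measure_le_Union[OF assms(1,2)] show ?thesis by linarith
qed

text \<open>
  This is the weak type (1,1) inequality of the maximal operator: the maximal sets of the family
  cover its union and are pairwise disjoint by nestedness, so that their \<open>N\<close>-masses add up to at
  most that of \<open>R\<close>, and sparseness bounds the sum of all measures by the measure of the union.
\<close>
lemma sum_measure_le_of_mean_ge:
  assumes N: "admissible N" and F: "finite F" "F \<subseteq> \<S>" "R \<in> \<S>" "\<And>Q. Q \<in> F \<Longrightarrow> Q \<subseteq> R"
    and t: "0 < t" "\<And>Q. Q \<in> F \<Longrightarrow> t \<le> mean N Q"
  shows "(\<Sum>Q\<in>F. measure M Q) \<le> 2 / t * measure N R"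
proof -
  define G where "G = {P\<in>F. \<forall>Q\<in>F. P \<subseteq> Q \<longrightarrow> Q = P}"
  have G: "finite G" "G \<subseteq> \<S>" "G \<subseteq> F" using F by (auto simp: G_def)
  have dis: "disjoint_family_on id G"
    unfolding disjoint_family_on_def
  proof (intro ballI impI)
    fix P Q assume PQ: "P \<in> G" "Q \<in> G" "P \<noteq> Q"
    then have "P \<subseteq> Q \<or> Q \<subseteq> P \<or> P \<inter> Q = {}" using G nested by blast
    with PQ show "id P \<inter> id Q = {}" by (auto simp: G_def)
  qed
  have finN: "P \<in> sets N" "emeasure N P \<noteq> \<infinity>" if "P \<in> G" for P
    using that G N sets unfolding admissible_def less_top infinity_ennreal_def by blast+
  have GR: "\<Union>G \<subseteq> R" using G F(4) by blast
  have "\<exists>P\<in>G. Q \<subseteq> P" if "Q \<in> F" for Q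
    using finite_has_maximal2[OF F(1) that] by (auto simp: G_def)
  then have un: "\<Union>F = \<Union>G" using G by blast
  have "measure M (\<Union>F) \<le> (\<Sum>P\<in>G. measure M P)"
    unfolding un using G sets by (intro measure_Union_le) auto
  also have "\<dots> \<le> (\<Sum>P\<in>G. measure N P / t)"
  proof (rule sum_mono)
    fix P assume "P \<in> G"
    then have "P \<in> F" "P \<in> \<S>" using G by auto
    then show "measure M P \<le> measure N P / t"
      using t(1) t(2)[of P] pos[of P] by (auto simp: mean_def field_simps)
  qed
  also have "\<dots> = (\<Sum>P\<in>G. measure N (id P)) / t" by (simp add: sum_divide_distrib)
  also have "(\<Sum>P\<in>G. measure N (id P)) = measure N (\<Union>P\<in>G. id P)"
    using G dis finN by (subst measure_finite_Union) auto
  also have "\<dots> \<le> measure N R"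
    using GR finN G(1) admissible_fmeasurable[OF N F(3)]
    by (intro measure_mono_fmeasurable) auto
  finally have "measure M (\<Union>F) \<le> measure N R / t" using t by (simp add: divide_right_mono)
  with sum_measure_le_Union[OF F(1,2)] show ?thesis by simp
qed

end

text \<open>If \<open>2\<^sup>k < z \<le> 2\<^sup>k\<^sup>+\<^sup>1\<close>, the summand with index \<open>k\<close> alone dominates the left-hand side.\<close>
lemma powr_le_dyadic_layers:
  fixes z g :: real
  assumes "0 < z" "z \<le> 2 ^ n" "0 \<le> g"
  shows "z powr g \<le> 1 + (\<Sum>k<n. 2 powr (real (Suc k) * g) * of_bool (2 ^ k < z))"
  using assms(2)
proof (induction n)
  case 0
  then show ?case using assms powr_le1[of g z] by simp
next
  case (Suc n)
  show ?case
  proof (cases "z \<le> 2 ^ n")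
    case True
    then show ?thesis using Suc.IH by simp
  next
    case False
    have "z powr g \<le> (2 ^ Suc n) powr g"
      using Suc.prems assms by (intro powr_mono2) auto
    also have "\<dots> = 2 powr (real (Suc n) * g)"
      by (subst powr_realpow[symmetric]) (simp_all only: powr_powr zero_less_numeral)
    finally have "z powr g \<le> 2 powr (real (Suc n) * g)" .
    moreover have "0 \<le> (\<Sum>k<n. 2 powr (real (Suc k) * g) * of_bool (2 ^ k < z))"
      by (intro sum_nonneg) auto
    ultimately show ?thesis using False by simp
  qed
qed

text \<open>
  The number 2 accounts for the sets whose mean does not exceed that of the ambient set, the
  geometric series with ratio \<open>2 powr (g - 1)\<close> for the dyadic levels of larger means.
\<close>
definition kolmogorov_const :: "real \<Rightarrow> real" where
  "kolmogorov_const g = 2 + 4 / (1 - 2 powr (g - 1))"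

lemma kolmogorov_const_pos: "g < 1 \<Longrightarrow> 0 < kolmogorov_const g"
  unfolding kolmogorov_const_def
  using powr_less_mono[of "g - 1" 0 2] by (intro add_pos_pos divide_pos_pos) auto

context nested_sparse
begin

text \<open>
  A discrete Kolmogorov inequality: by the weak type (1,1) bound, powers of the maximal function with
  an exponent below 1 are locally integrable. At the level \<open>2\<^sup>k\<close> of the
  normalised mean the weak type bound gains \<open>2 powr - k\<close>, which beats the loss \<open>2 powr (k * g)\<close>
  as \<open>g < 1\<close>. The exponent \<open>h\<close> makes the constant uniform in \<open>g \<le> h\<close>.
\<close>
lemma sum_mean_powr_le:
  assumes N: "admissible N" and F: "finite F" "F \<subseteq> \<S>" "R \<in> \<S>" "\<And>Q. Q \<in> F \<Longrightarrow> Q \<subseteq> R"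
    and g: "0 \<le> g" "g \<le> h" "h < 1"
  shows "(\<Sum>Q\<in>F. (mean N Q / mean N R) powr g * measure M Q) \<le> kolmogorov_const h * measure M R"
proof -
  define z where "z Q = mean N Q / mean N R" for Q
  define q :: real where "q = 2 powr (h - 1)"
  have q: "0 < q" "q < 1" using powr_less_mono[of "h - 1" 0 2] g by (auto simp: q_def)
  have z: "0 < z Q" if "Q \<in> F" for Q using that F mean_pos[OF N] by (auto simp: z_def)
  obtain n where n: "z Q \<le> 2 ^ n" if "Q \<in> F" for Q
  proof -
    have "\<exists>B. \<forall>Q\<in>F. z Q \<le> B" using F(1) by (meson finite_imageI image_eqI Max_ge)
    then obtain B where B: "\<And>Q. Q \<in> F \<Longrightarrow> z Q \<le> B" by auto
    obtain n where "B < 2 ^ n" using real_arch_pow[of 2 B] by auto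
    with B that show thesis by (meson less_imp_le order_trans)
  qed
  have level: "(\<Sum>Q\<in>{Q\<in>F. 2 ^ k < z Q}. measure M Q) \<le> 2 / 2 ^ k * measure M R" for k :: nat
  proof -
    have "(\<Sum>Q\<in>{Q\<in>F. 2 ^ k < z Q}. measure M Q) \<le> 2 / (2 ^ k * mean N R) * measure N R"
      using F mean_pos[OF N F(3)]
      by (intro sum_measure_le_of_mean_ge[OF N]) (auto simp: z_def field_simps)
    also have "\<dots> = 2 / 2 ^ k * measure M R"
      using mean_mult[OF F(3), of N] mean_pos[OF N F(3)] by (auto simp: field_simps)
    finally show ?thesis .
  qed
  have coeff: "2 powr (real (Suc k) * g) * (2 / 2 ^ k) \<le> 4 * q ^ k" for k
  proof -
    have "2 powr (real (Suc k) * g) \<le> (2::real) powr (real (Suc k) * h)"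
      using g by (intro powr_mono mult_left_mono) auto
    also have "\<dots> = 2 powr h * (2 powr h) ^ k"
      by (simp add: powr_add distrib_right powr_powr[symmetric] powr_realpow[symmetric] mult.commute)
    also have "\<dots> \<le> 2 * (2 powr h) ^ k"
      using g powr_mono[of h 1 2] by (intro mult_right_mono) auto
    also have "(2 powr h) ^ k = 2 ^ k * q ^ k"
      by (simp add: q_def powr_diff power_divide)
    finally show ?thesis by (simp add: field_simps)
  qed
  have "(\<Sum>Q\<in>F. z Q powr g * measure M Q)
      \<le> (\<Sum>Q\<in>F. (1 + (\<Sum>k<n. 2 powr (real (Suc k) * g) * of_bool (2 ^ k < z Q))) * measure M Q)"
    using z n g by (intro sum_mono mult_right_mono powr_le_dyadic_layers) auto
  also have "\<dots> = (\<Sum>Q\<in>F. measure M Q)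
      + (\<Sum>k<n. 2 powr (real (Suc k) * g) * (\<Sum>Q\<in>F. of_bool (2 ^ k < z Q) * measure M Q))"
    unfolding distrib_right sum.distrib sum_distrib_left sum_distrib_right mult.assoc
    by (subst (2) sum.swap) simp
  also have "\<dots> = (\<Sum>Q\<in>F. measure M Q)
      + (\<Sum>k<n. 2 powr (real (Suc k) * g) * (\<Sum>Q\<in>{Q\<in>F. 2 ^ k < z Q}. measure M Q))"
    using F(1) by (intro arg_cong2[where f = "(+)"] refl sum.cong arg_cong2[where f = "(*)"]
        sum.mono_neutral_cong_right) auto
  also have "\<dots> \<le> 2 * measure M R + (\<Sum>k<n. 2 powr (real (Suc k) * g) * (2 / 2 ^ k * measure M R))"
    using sum_measure_le[OF F] level by (intro add_mono sum_mono mult_left_mono) auto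
  also have "\<dots> \<le> 2 * measure M R + (\<Sum>k<n. 4 * q ^ k * measure M R)"
    using mult_right_mono[OF coeff, of "measure M R"] by (intro add_mono sum_mono) (auto simp: mult.assoc)
  also have "(\<Sum>k<n. 4 * q ^ k * measure M R) = 4 * (\<Sum>k<n. q ^ k) * measure M R"
    by (simp add: sum_distrib_left sum_distrib_right)
  also have "2 * measure M R + \<dots> \<le> 2 * measure M R + 4 * (1 / (1 - q)) * measure M R"
  proof -
    have "(\<Sum>k<n. q ^ k) \<le> 1 / (1 - q)"
      using q by (simp add: sum_gp_strict divide_right_mono)
    then show ?thesis by (intro add_left_mono mult_right_mono) auto
  qed
  also have "\<dots> = kolmogorov_const h * measure M R"
    by (simp add: kolmogorov_const_def q_def distrib_right)
  finally show ?thesis by (simp add: z_def)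
qed

text \<open>
  Normalised by their values at \<open>R\<close>, two means satisfy \<open>x powr a * y powr b \<le> (max x y) powr (a + b)\<close>,
  which reduces the product to the case of one measure at the exponent \<open>a + b < 1\<close>.
\<close>
lemma sum_mean_powr_mult_mean_powr_le:
  assumes N: "admissible N" "admissible N'"
    and F: "finite F" "F \<subseteq> \<S>" "R \<in> \<S>" "\<And>Q. Q \<in> F \<Longrightarrow> Q \<subseteq> R"
    and ab: "0 \<le> a" "0 \<le> b" "a + b \<le> h" "h < 1"
  shows "(\<Sum>Q\<in>F. mean N Q powr a * mean N' Q powr b * measure M Q)
      \<le> 2 * kolmogorov_const h * (mean N R powr a * mean N' R powr b * measure M R)"
proof -
  let ?x = "\<lambda>Q. mean N Q / mean N R" and ?y = "\<lambda>Q. mean N' Q / mean N' R"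
  let ?r = "mean N R powr a * mean N' R powr b"
  have mix: "x powr a * y powr b \<le> x powr (a + b) + y powr (a + b)" if "0 < x" "0 < y" for x y :: real
  proof (cases "x \<le> y")
    case True
    then have "x powr a * y powr b \<le> y powr a * y powr b"
      using that ab by (intro mult_right_mono powr_mono2) auto
    then show ?thesis by (simp add: powr_add add_increasing)
  next
    case False
    then have "x powr a * y powr b \<le> x powr a * x powr b"
      using that ab by (intro mult_left_mono powr_mono2) auto
    then show ?thesis by (simp add: powr_add add_increasing2)
  qed
  have "mean N Q powr a * mean N' Q powr b * measure M Q
      \<le> ?r * (?x Q powr (a + b) * measure M Q + ?y Q powr (a + b) * measure M Q)" if "Q \<in> F" for Q
  proof -
    have Q: "Q \<in> \<S>" using that F by auto
    have "mean N Q powr a * mean N' Q powr b = ?r * (?x Q powr a * ?y Q powr b)"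
      using mean_pos[OF N(1) F(3)] mean_pos[OF N(2) F(3)] by (simp add: powr_divide)
    also have "\<dots> \<le> ?r * (?x Q powr (a + b) + ?y Q powr (a + b))"
      using mean_pos[OF N(1)] mean_pos[OF N(2)] F(3) Q by (intro mult_left_mono mix) auto
    finally show ?thesis
      using mult_right_mono[of _ _ "measure M Q"] by (fastforce simp: algebra_simps)
  qed
  then have "(\<Sum>Q\<in>F. mean N Q powr a * mean N' Q powr b * measure M Q)
      \<le> (\<Sum>Q\<in>F. ?r * (?x Q powr (a + b) * measure M Q + ?y Q powr (a + b) * measure M Q))"
    by (rule sum_mono)
  also have "\<dots> = ?r * ((\<Sum>Q\<in>F. ?x Q powr (a + b) * measure M Q)
      + (\<Sum>Q\<in>F. ?y Q powr (a + b) * measure M Q))"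
    by (simp add: sum_distrib_left[symmetric] sum.distrib)
  also have "\<dots> \<le> ?r * (kolmogorov_const h * measure M R + kolmogorov_const h * measure M R)"
    using ab by (intro mult_left_mono add_mono sum_mean_powr_le N F) auto
  finally show ?thesis by (simp add: algebra_simps)
qed

end

section \<open>Mixed estimates with a joint bound on the means\<close>

lemma affine_nonneg_between:
  fixes a b t T :: real
  assumes "0 \<le> a" "0 \<le> a + T * b" "0 \<le> t" "t \<le> T"
  shows "0 \<le> a + t * b"
proof (cases "0 \<le> b")
  case False
  then have "T * b \<le> t * b" using assms by (intro mult_right_mono_neg) auto
  then show ?thesis using assms by linarith
qed (use assms in auto)

text \<open>
  The exponent is written as \<open>s = m + n + 1\<close> with \<open>0 < m \<le> 1\<close>, and \<open>n\<close> induction steps start from \<open>m\<close>.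
  The exponents of the two means add up to \<open>1 - \<delta> * (m + j)\<close> after \<open>j\<close> steps, so the Kolmogorov
  constant for \<open>j = 0\<close> serves all of them.
\<close>
definition chain_const :: "real \<Rightarrow> real \<Rightarrow> real" where
  "chain_const \<delta> s =
    (let n = nat \<lceil>s - 1\<rceil> - 1; m = s - 1 - real n; c = 2 * kolmogorov_const (1 - \<delta> * m)
     in s * (c * (\<Prod>i=1..n. c * (m + real i))))"

lemma frac_decomposition:
  fixes s :: real
  assumes "1 < s"
  defines "m \<equiv> s - 1 - real (nat \<lceil>s - 1\<rceil> - 1)"
  shows "0 < m" "m \<le> 1"
proof -
  have "1 \<le> \<lceil>s - 1\<rceil>" using assms by (simp add: one_le_ceiling)
  then have "real (nat \<lceil>s - 1\<rceil> - 1) = of_int \<lceil>s - 1\<rceil> - 1"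
    by (subst of_nat_diff) (auto simp only: of_nat_nat of_nat_1 nat_1[symmetric] nat_mono)
  then have "m = s - 1 - (of_int \<lceil>s - 1\<rceil> - 1)" unfolding m_def by simp
  then show "0 < m" "m \<le> 1" using ceiling_correct[of "s - 1"] by linarith+
qed

lemma chain_const_pos:
  assumes "1 < s" "0 < \<delta>"
  shows "0 < chain_const \<delta> s"
proof -
  have c: "0 < kolmogorov_const (1 - \<delta> * m)" if "0 < m" for m
    using that assms by (intro kolmogorov_const_pos) auto
  show ?thesis
    using assms c frac_decomposition[OF assms(1)] unfolding chain_const_def Let_def
    by (intro mult_pos_pos prod_pos) (auto intro!: add_pos_nonneg)
qed

context nested_sparse
begin

text \<open>
  Let \<open>x\<close>, \<open>y\<close> be the means of \<open>N\<close>, \<open>N'\<close>, so that \<open>y * x powr (p - 1) \<le> K\<close>. With the exponent \<open>t\<close>,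
  the local integrals at \<open>Q\<close> scale like \<open>x powr (c + t * u) * y powr (d + t * v)\<close> times the measure
  of \<open>Q\<close>, whose exponents add up to \<open>1 + t * (u + v)\<close>; this is too much for Kolmogorov's inequality
  when \<open>u + v \<ge> 0\<close>. The bound by \<open>K\<close>, used with the power \<open>t * l\<close>, lowers the sum of the exponents by
  \<open>t * p * l\<close>, and it falls below 1 as soon as \<open>p * l > u + v\<close>. All exponents are affine in \<open>t\<close>, so
  nonnegativity at \<open>t = 0\<close> and \<open>t = s - 1\<close> suffices. In the last step, from \<open>s - 1\<close> to \<open>s\<close>, no summation
  is carried out; a further power \<open>g\<close> of the bound by \<open>K\<close> brings the summand into the form
  \<open>x powr c' * y powr d'\<close>.
\<close>
lemma nn_integral_mean_powr_sum_le:
  assumes N: "admissible N" and N': "admissible N'" and L: "sets L = sets M"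
    and L_le: "\<And>Q. Q \<in> \<S> \<Longrightarrow> emeasure L Q \<le> ennreal (mean N Q powr c * mean N' Q powr d * measure M Q)"
    and K: "\<And>Q. Q \<in> \<S> \<Longrightarrow> mean N' Q * mean N Q powr (p - 1) \<le> K"
    and cd: "0 \<le> c" "0 \<le> d" "c + d = 1"
    and l: "0 \<le> l" "u + v < p * l" and s: "1 < s"
    and expo: "0 \<le> c + (s - 1) * (u - (p - 1) * l)" "0 \<le> d + (s - 1) * (v - l)"
    and g: "0 \<le> g" "u + c + (s - 1) * (u - (p - 1) * l) = c' + (p - 1) * g"
      "v + d + (s - 1) * (v - l) = d' + g"
    and F: "finite F" "F \<subseteq> \<S>"
  shows "(\<integral>\<^sup>+x. ennreal (step_sum (\<lambda>Q. mean N Q powr u * mean N' Q powr v) F x powr s) \<partial>L)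
      \<le> ennreal (chain_const (p * l - (u + v)) s * K powr ((s - 1) * l + g)
          * (\<Sum>Q\<in>F. mean N Q powr c' * mean N' Q powr d' * measure M Q))"
proof (cases "F = {}")
  case False
  define n where "n = nat \<lceil>s - 1\<rceil> - 1"
  define m where "m = s - 1 - real n"
  define h where "h = 1 - (p * l - (u + v)) * m"
  define k where "k = 2 * kolmogorov_const h"
  define C where "C = k * (\<Prod>i=1..n. k * (m + real i))"
  have m: "0 < m" "m \<le> 1" "m + real n = s - 1"
    using frac_decomposition[OF s] by (auto simp: m_def n_def)
  have h1: "h < 1" using l m by (simp add: h_def)
  have k: "0 < k" using kolmogorov_const_pos[OF h1] by (simp add: k_def)
  have const: "chain_const (p * l - (u + v)) s = s * C"
    by (simp add: chain_const_def Let_def C_def k_def h_def m_def n_def)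
  have C: "0 \<le> C" unfolding C_def using k m by (intro mult_nonneg_nonneg prod_nonneg) auto
  let ?X = "mean N" and ?Y = "mean N'" and ?a = "\<lambda>Q. mean N Q powr u * mean N' Q powr v"
  note X = mean_pos[OF N] and Y = mean_pos[OF N']
  have Kpos: "0 < K" using False F X Y K
    by (metis all_not_in_conv less_le_trans mult_pos_pos powr_gt_zero subsetD less_irrefl)
  define A where "A t = c + t * (u - (p - 1) * l)" for t
  define B where "B t = d + t * (v - l)" for t
  define \<Phi> where "\<Phi> j Q = K powr ((m + real j) * l) * ?X Q powr A (m + real j)
      * ?Y Q powr B (m + real j) * measure M Q" for j :: nat and Q
  \<comment> \<open>A power of \<open>y * x powr (p - 1)\<close> is split off and estimated by the same power of \<open>K\<close>.\<close>
  have gain: "x powr a * y powr b \<le> K powr e * x powr (a - (p - 1) * e) * y powr (b - e)"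
    if "0 \<le> e" "0 < x" "0 < y" "y * x powr (p - 1) \<le> K" for x y a b e
  proof -
    have "x powr a * y powr b = (y * x powr (p - 1)) powr e * x powr (a - (p - 1) * e) * y powr (b - e)"
    proof -
      have "(y * x powr (p - 1)) powr e = y powr e * x powr ((p - 1) * e)"
        by (simp only: powr_mult powr_powr)
      then show ?thesis using that by (simp add: powr_diff)
    qed
    also have "\<dots> \<le> K powr e * x powr (a - (p - 1) * e) * y powr (b - e)"
      using that by (intro mult_right_mono powr_mono2) auto
    finally show ?thesis .
  qed
  have step: "?a Q * \<Phi> j Q \<le> \<Phi> (Suc j) Q" if Q: "Q \<in> \<S>" for j Q
  proof -
    let ?t = "m + real j"
    have "?a Q * \<Phi> j Q = K powr (?t * l) * (?X Q powr (u + A ?t) * ?Y Q powr (v + B ?t)) * measure M Q"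
      by (simp add: \<Phi>_def powr_add mult_ac)
    also have "\<dots> \<le> K powr (?t * l) * (K powr l * ?X Q powr (u + A ?t - (p - 1) * l)
        * ?Y Q powr (v + B ?t - l)) * measure M Q"
      using l X[OF Q] Y[OF Q] K[OF Q] by (intro mult_right_mono mult_left_mono gain) auto
    also have "\<dots> = K powr (?t * l + l) * ?X Q powr (u + A ?t - (p - 1) * l)
        * ?Y Q powr (v + B ?t - l) * measure M Q"
      by (simp add: powr_add mult_ac)
    also have "\<dots> = \<Phi> (Suc j) Q"
      by (simp add: \<Phi>_def A_def B_def algebra_simps)
    finally show ?thesis .
  qed
  have base: "ennreal (?a Q powr m) * emeasure L Q \<le> ennreal (\<Phi> 0 Q)" if Q: "Q \<in> \<S>" for Q
  proof -
    have "ennreal (?a Q powr m) * emeasure L Q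
        \<le> ennreal (?a Q powr m) * ennreal (?X Q powr c * ?Y Q powr d * measure M Q)"
      using L_le[OF Q] by (intro mult_left_mono) auto
    also have "\<dots> = ennreal (?X Q powr (u * m + c) * ?Y Q powr (v * m + d) * measure M Q)"
      by (simp add: ennreal_mult[symmetric] powr_mult powr_powr powr_add mult_ac)
    also have "\<dots> \<le> ennreal (K powr (m * l) * ?X Q powr (u * m + c - (p - 1) * (m * l))
        * ?Y Q powr (v * m + d - m * l) * measure M Q)"
      using l m X[OF Q] Y[OF Q] K[OF Q] by (intro ennreal_leI mult_right_mono gain) auto
    also have "\<dots> = ennreal (\<Phi> 0 Q)"
      by (simp add: \<Phi>_def A_def B_def algebra_simps)
    finally show ?thesis .
  qed
  have carleson: "(\<Sum>Q\<in>G. \<Phi> j Q) \<le> k * \<Phi> j R"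
    if j: "j \<le> n" and G: "finite G" "G \<subseteq> \<S>" "R \<in> \<S>" "\<And>Q. Q \<in> G \<Longrightarrow> Q \<subseteq> R" for j G R
  proof -
    let ?t = "m + real j"
    have t: "m \<le> ?t" "?t \<le> s - 1" using m j by auto
    have AB: "0 \<le> A ?t" "0 \<le> B ?t"
      unfolding A_def B_def using expo cd t m
      by (auto intro: affine_nonneg_between[where T = "s - 1"])
    have "A ?t + B ?t = 1 - (p * l - (u + v)) * ?t"
      using cd by (simp add: A_def B_def algebra_simps)
    also have "\<dots> \<le> h" unfolding h_def using l t by (intro diff_left_mono mult_left_mono) auto
    finally have h: "A ?t + B ?t \<le> h" .
    have "(\<Sum>Q\<in>G. \<Phi> j Q)
        = K powr (?t * l) * (\<Sum>Q\<in>G. ?X Q powr A ?t * ?Y Q powr B ?t * measure M Q)"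
      by (simp add: \<Phi>_def sum_distrib_left mult_ac)
    also have "\<dots> \<le> K powr (?t * l) * (k * (?X R powr A ?t * ?Y R powr B ?t * measure M R))"
      unfolding k_def
      by (intro mult_left_mono sum_mean_powr_mult_mean_powr_le[OF N N' G AB h h1]) auto
    finally show ?thesis by (simp add: \<Phi>_def mult_ac)
  qed
  have "(\<integral>\<^sup>+x. ennreal (step_sum ?a F x powr s) \<partial>L) \<le> ennreal (s * (\<Sum>Q\<in>F. ?a Q * (C * \<Phi> n Q)))"
  proof (rule nn_integral_step_sum_powr_step)
    fix Q assume Q: "Q \<in> F"
    have "(\<integral>\<^sup>+x. ennreal (step_sum ?a {P \<in> F. P \<subseteq> Q} x powr (m + real n)) \<partial>L) \<le> ennreal (C * \<Phi> n Q)"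
      unfolding C_def
      by (rule nn_integral_step_sum_powr_iterate[where \<S> = \<S> and n = n])
        (use L sets nested m k base step carleson F Q in \<open>auto simp: \<Phi>_def less_imp_le\<close>)
    then show "(\<integral>\<^sup>+x. ennreal (step_sum ?a {P \<in> F. P \<subseteq> Q} x powr (s - 1)) \<partial>L) \<le> ennreal (C * \<Phi> n Q)"
      by (simp add: m(3))
    show "0 \<le> C * \<Phi> n Q" using C by (simp add: \<Phi>_def)
  next
    fix P Q assume "P \<in> F" "Q \<in> F"
    then show "P \<subseteq> Q \<or> Q \<subseteq> P \<or> P \<inter> Q = {}" using F by (intro nested) auto
  qed (use F L sets s in auto)
  also have "\<dots> \<le> ennreal (s * C * K powr ((s - 1) * l + g)
      * (\<Sum>Q\<in>F. ?X Q powr c' * ?Y Q powr d' * measure M Q))"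
  proof (rule ennreal_leI)
    have final: "?a Q * \<Phi> n Q \<le> K powr ((s - 1) * l + g) * (?X Q powr c' * ?Y Q powr d' * measure M Q)"
      if "Q \<in> F" for Q
    proof -
      have Q: "Q \<in> \<S>" using that F by auto
      have "?a Q * \<Phi> n Q = K powr ((s - 1) * l)
          * (?X Q powr (c' + (p - 1) * g) * ?Y Q powr (d' + g)) * measure M Q"
        unfolding g(2,3)[symmetric] by (simp add: \<Phi>_def m(3) A_def B_def powr_add mult_ac)
      also have "\<dots> \<le> K powr ((s - 1) * l) * (K powr g * ?X Q powr (c' + (p - 1) * g - (p - 1) * g)
          * ?Y Q powr (d' + g - g)) * measure M Q"
        using g(1) X[OF Q] Y[OF Q] K[OF Q] by (intro mult_right_mono mult_left_mono gain) auto
      finally show ?thesis by (simp add: powr_add mult_ac)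
    qed
    have "s * (\<Sum>Q\<in>F. ?a Q * (C * \<Phi> n Q)) = s * C * (\<Sum>Q\<in>F. ?a Q * \<Phi> n Q)"
      unfolding sum_distrib_left by (intro sum.cong) (simp_all only: mult_ac)
    also have "\<dots> \<le> s * C * (\<Sum>Q\<in>F. K powr ((s - 1) * l + g) * (?X Q powr c' * ?Y Q powr d' * measure M Q))"
      using s C final by (intro mult_left_mono sum_mono) auto
    finally show "s * (\<Sum>Q\<in>F. ?a Q * (C * \<Phi> n Q)) \<le> s * C * K powr ((s - 1) * l + g)
        * (\<Sum>Q\<in>F. ?X Q powr c' * ?Y Q powr d' * measure M Q)"
      by (simp only: sum_distrib_left[symmetric] mult.assoc)
  qed
  finally show ?thesis by (simp add: const)
qed simp

end

text \<open>
  With \<open>x\<close> and \<open>y\<close> the means of \<open>\<sigma>\<close> and \<open>w\<close>, the case \<open>p \<le> r\<close> is subadditivity of the power, since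
  \<open>(x powr r) powr (p / r) * y = (y * x powr (p - 1)) * x\<close>. For \<open>r < p\<close> the general estimate is used
  with \<open>(u, v) = (r, 0)\<close> and the measure \<open>w\<close>, that is \<open>(c, d) = (0, 1)\<close>; it ends at \<open>x\<close> times the
  volume, which is the \<open>\<sigma>\<close>-mass. The quantifier over all families and measures stands inside, as
  the constant must not depend on them.
\<close>
lemma testing_sum_le:
  fixes r p :: real
  assumes r: "0 < r" and p: "1 < p"
  obtains C where "0 < C"
    and "\<And>(M :: 'a measure) \<S> E N N' F K. nested_sparse M \<S> E \<Longrightarrow> nested_sparse.admissible M \<S> N \<Longrightarrow>
      nested_sparse.admissible M \<S> N' \<Longrightarrow> finite F \<Longrightarrow> F \<subseteq> \<S> \<Longrightarrow>
      (\<And>Q. Q \<in> \<S> \<Longrightarrow> nested_sparse.mean M N' Q * nested_sparse.mean M N Q powr (p - 1) \<le> K) \<Longrightarrow>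
      (\<integral>\<^sup>+x. ennreal (step_sum (\<lambda>Q. nested_sparse.mean M N Q powr r) F x powr (p / r)) \<partial>N')
        \<le> ennreal (C * K * (\<Sum>Q\<in>F. measure N Q))"
proof (cases "p \<le> r")
  case True
  show thesis
  proof
    fix M :: "'a measure" and \<S> E N N' F K
    assume S: "nested_sparse M \<S> E" and N: "nested_sparse.admissible M \<S> N"
      and N': "nested_sparse.admissible M \<S> N'" and F: "finite F" "F \<subseteq> \<S>"
      and K: "\<And>Q. Q \<in> \<S> \<Longrightarrow> nested_sparse.mean M N' Q * nested_sparse.mean M N Q powr (p - 1) \<le> K"
    interpret nested_sparse M \<S> E by (rule S)
    have "(\<integral>\<^sup>+x. ennreal (step_sum (\<lambda>Q. mean N Q powr r) F x powr (p / r)) \<partial>N')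
        \<le> (\<Sum>Q\<in>F. ennreal ((mean N Q powr r) powr (p / r)) * emeasure N' Q)"
      using F N' sets True r p
      by (intro nn_integral_step_sum_powr_le_one) (auto simp: admissible_def)
    also have "\<dots> \<le> (\<Sum>Q\<in>F. ennreal (K * measure N Q))"
    proof (rule sum_mono)
      fix Q assume "Q \<in> F"
      then have Q: "Q \<in> \<S>" using F by auto
      have "emeasure N' Q = ennreal (mean N' Q * measure M Q)"
        using N' Q by (simp add: mean_mult admissible_def emeasure_eq_ennreal_measure less_top)
      then have "ennreal ((mean N Q powr r) powr (p / r)) * emeasure N' Q
          = ennreal ((mean N Q powr r) powr (p / r) * (mean N' Q * measure M Q))"
        using mean_pos[OF N' Q] by (simp add: ennreal_mult)
      also have "(mean N Q powr r) powr (p / r) * (mean N' Q * measure M Q)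
          = (mean N' Q * mean N Q powr (p - 1)) * measure N Q"
        using r mean_mult[OF Q, of N, symmetric] mean_pos[OF N Q]
        by (simp add: powr_powr powr_diff)
      also have "ennreal \<dots> \<le> ennreal (K * measure N Q)"
        using K[OF Q] by (intro ennreal_leI mult_right_mono) auto
      finally show "ennreal ((mean N Q powr r) powr (p / r)) * emeasure N' Q \<le> ennreal (K * measure N Q)" .
    qed
    also have "\<dots> = ennreal (1 * K * (\<Sum>Q\<in>F. measure N Q))"
    proof -
      have "0 \<le> K * measure N Q" if "Q \<in> F" for Q
      proof -
        have Q: "Q \<in> \<S>" using that F(2) by auto
        have "0 \<le> mean N' Q * mean N Q powr (p - 1)" using mean_pos[OF N' Q] by simp
        with K[OF Q] show ?thesis by (intro mult_nonneg_nonneg) auto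
      qed
      then show ?thesis by (simp add: sum_distrib_left)
    qed
    finally show "(\<integral>\<^sup>+x. ennreal (step_sum (\<lambda>Q. mean N Q powr r) F x powr (p / r)) \<partial>N')
        \<le> ennreal (1 * K * (\<Sum>Q\<in>F. measure N Q))" .
  qed simp
next
  case False
  \<comment> \<open>Any \<open>l\<close> strictly above \<open>r / p\<close> makes Kolmogorov's inequality applicable. The two upper bounds
    express that the exponents of \<open>x\<close> and \<open>y\<close> at \<open>t = p / r - 1\<close> are nonnegative.\<close>
  define l where "l = min (r / (p - 1)) (r / (p - r))"
  have rp: "r / p < l" unfolding l_def using r p False by (simp add: divide_strict_left_mono)
  have l0: "0 \<le> l" unfolding l_def using r p False by auto
  have "r < p * l" using rp p by (simp add: field_simps)
  have l1: "(p - 1) * l \<le> r" 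
  proof -
    have "l \<le> r / (p - 1)" by (simp add: l_def)
    then show ?thesis using p by (simp add: field_simps)
  qed
  have l2: "(p / r - 1) * l \<le> 1"
  proof -
    have "l \<le> r / (p - r)" by (simp add: l_def)
    then show ?thesis using False r by (simp add: field_simps)
  qed
  show thesis
  proof
    show "0 < chain_const (p * l - (r + 0)) (p / r)"
      using \<open>r < p * l\<close> False r by (intro chain_const_pos) auto
    fix M :: "'a measure" and \<S> E N N' F K
    assume S: "nested_sparse M \<S> E" and N: "nested_sparse.admissible M \<S> N"
      and N': "nested_sparse.admissible M \<S> N'" and F: "finite F" "F \<subseteq> \<S>"
      and K: "\<And>Q. Q \<in> \<S> \<Longrightarrow> nested_sparse.mean M N' Q * nested_sparse.mean M N Q powr (p - 1) \<le> K"
    interpret nested_sparse M \<S> E by (rule S)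
    let ?C = "chain_const (p * l - (r + 0)) (p / r)"
    show "(\<integral>\<^sup>+x. ennreal (step_sum (\<lambda>Q. mean N Q powr r) F x powr (p / r)) \<partial>N')
        \<le> ennreal (?C * K * (\<Sum>Q\<in>F. measure N Q))"
    proof (cases "F = {}")
      case Fne: False
      then have K0: "0 < K" using F mean_pos[OF N] mean_pos[OF N'] K
        by (metis all_not_in_conv less_le_trans mult_pos_pos powr_gt_zero subsetD less_irrefl)
      have "(\<integral>\<^sup>+x. ennreal (step_sum (\<lambda>Q. mean N Q powr r * mean N' Q powr 0) F x powr (p / r)) \<partial>N')
          \<le> ennreal (?C * K powr ((p / r - 1) * l + (1 - (p / r - 1) * l))
            * (\<Sum>Q\<in>F. mean N Q powr 1 * mean N' Q powr 0 * measure M Q))"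
      proof (rule nn_integral_mean_powr_sum_le[where c = 0 and d = 1 and p = p, OF N N'])
        fix Q assume Q: "Q \<in> \<S>"
        then show "emeasure N' Q \<le> ennreal (mean N Q powr 0 * mean N' Q powr 1 * measure M Q)"
          using N' mean_pos[OF N Q] mean_pos[OF N' Q] mean_mult[OF Q, of N']
          by (simp add: admissible_def emeasure_eq_ennreal_measure less_top)
      next
        show "r + 0 + (p / r - 1) * (r - (p - 1) * l) = 1 + (p - 1) * (1 - (p / r - 1) * l)"
          using r by (simp add: field_simps)
      next
        show "0 \<le> 0 + (p / r - 1) * (r - (p - 1) * l)"
          using r l1 False by (intro add_nonneg_nonneg mult_nonneg_nonneg) auto
      qed (use N' K l0 \<open>r < p * l\<close> False r l2 F in \<open>auto simp: admissible_def algebra_simps\<close>)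
      moreover have "step_sum (\<lambda>Q. mean N Q powr r * mean N' Q powr 0) F x
          = step_sum (\<lambda>Q. mean N Q powr r) F x" for x
        using F mean_pos[OF N'] by (intro sum.cong) (auto simp: subset_eq less_le)
      moreover have "(\<Sum>Q\<in>F. mean N Q powr 1 * mean N' Q powr 0 * measure M Q) = (\<Sum>Q\<in>F. measure N Q)"
      proof (rule sum.cong)
        fix Q assume "Q \<in> F"
        then have Q: "Q \<in> \<S>" using F by auto
        show "mean N Q powr 1 * mean N' Q powr 0 * measure M Q = measure N Q"
          using mean_pos[OF N Q] mean_pos[OF N' Q] mean_mult[OF Q, of N] by simp
      qed simp
      moreover have "K powr ((p / r - 1) * l + (1 - (p / r - 1) * l)) = K" using K0 by simp
      ultimately show ?thesis by simp
    qed simp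
  qed
qed

text \<open>
  The same scheme with \<open>(u, v) = (r - 1, 1)\<close> and the measure \<open>\<sigma>\<close>, that is \<open>(c, d) = (1, 0)\<close>. It ends
  at \<open>y\<close> times the volume, so the masses that remain to be summed are those of \<open>w\<close>.
\<close>
lemma dual_testing_sum_le:
  fixes r p :: real
  assumes r: "0 < r" and p: "1 < p" and rp: "r < p"
  obtains C where "0 < C"
    and "\<And>(M :: 'a measure) \<S> E N N' F K. nested_sparse M \<S> E \<Longrightarrow> nested_sparse.admissible M \<S> N \<Longrightarrow>
      nested_sparse.admissible M \<S> N' \<Longrightarrow> finite F \<Longrightarrow> F \<subseteq> \<S> \<Longrightarrow>
      (\<And>Q. Q \<in> \<S> \<Longrightarrow> nested_sparse.mean M N' Q * nested_sparse.mean M N Q powr (p - 1) \<le> K) \<Longrightarrow>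
      (\<integral>\<^sup>+x. ennreal (step_sum (\<lambda>Q. nested_sparse.mean M N Q powr (r - 1) * nested_sparse.mean M N' Q)
          F x powr (p / (p - r))) \<partial>N)
        \<le> ennreal (C * K powr (r / (p - r)) * (\<Sum>Q\<in>F. measure N' Q))"
proof -
  define t where "t = r / (p - r)"
  have t: "p / (p - r) = 1 + t" "0 < t" "r + t * (r - 1) = t * (p - 1)"
    using rp r by (auto simp: t_def field_simps)
  \<comment> \<open>The upper bounds on \<open>l\<close> come again from the exponents of \<open>y\<close> and \<open>x\<close>, here at \<open>t = r / (p - r)\<close>.
    The second one leaves room above \<open>r / p\<close> precisely because \<open>(p - r)\<^sup>2 > 0\<close>.\<close>
  define l where "l = min 1 ((p - 2 * r + r\<^sup>2) / (r * (p - 1)))"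
  have rpl: "r < p * l"
  proof -
    have "0 < (p - r)\<^sup>2" using rp by simp
    then have "r * (r * (p - 1)) < p * (p - 2 * r + r\<^sup>2)"
      by (simp add: power2_eq_square algebra_simps)
    then have "r < p * ((p - 2 * r + r\<^sup>2) / (r * (p - 1)))"
      using r p by (simp add: pos_less_divide_eq)
    then show ?thesis using rp by (simp add: l_def min_def)
  qed
  have l0: "0 \<le> l" using rpl r p by (smt (verit) mult_nonneg_nonpos)
  have l1: "l \<le> 1" by (simp add: l_def)
  have l2: "0 \<le> 1 + t * (r - 1 - (p - 1) * l)"
  proof -
    have "l \<le> (p - 2 * r + r\<^sup>2) / (r * (p - 1))" by (simp add: l_def)
    then have "l * (r * (p - 1)) \<le> p - 2 * r + r\<^sup>2" using r p by (simp add: pos_le_divide_eq)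
    then have "0 \<le> (p - r) + r * (r - 1 - (p - 1) * l)"
      by (simp add: power2_eq_square algebra_simps)
    then have "0 \<le> ((p - r) + r * (r - 1 - (p - 1) * l)) / (p - r)" using rp by simp
    also have "\<dots> = 1 + t * (r - 1 - (p - 1) * l)" using rp by (simp add: t_def add_divide_distrib)
    finally show ?thesis .
  qed
  show thesis
  proof
    show "0 < chain_const (p * l - (r - 1 + 1)) (1 + t)"
      using rpl t by (intro chain_const_pos) auto
    fix M :: "'a measure" and \<S> E N N' F K
    assume S: "nested_sparse M \<S> E" and N: "nested_sparse.admissible M \<S> N"
      and N': "nested_sparse.admissible M \<S> N'" and F: "finite F" "F \<subseteq> \<S>"
      and K: "\<And>Q. Q \<in> \<S> \<Longrightarrow> nested_sparse.mean M N' Q * nested_sparse.mean M N Q powr (p - 1) \<le> K"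
    interpret nested_sparse M \<S> E by (rule S)
    let ?C = "chain_const (p * l - (r - 1 + 1)) (1 + t)"
    have "(\<integral>\<^sup>+x. ennreal (step_sum (\<lambda>Q. mean N Q powr (r - 1) * mean N' Q powr 1) F x powr (1 + t)) \<partial>N)
        \<le> ennreal (?C * K powr ((1 + t - 1) * l + t * (1 - l))
          * (\<Sum>Q\<in>F. mean N Q powr 0 * mean N' Q powr 1 * measure M Q))"
    proof (rule nn_integral_mean_powr_sum_le[where c = 1 and d = 0 and p = p, OF N N'])
      fix Q assume Q: "Q \<in> \<S>"
      then show "emeasure N Q \<le> ennreal (mean N Q powr 1 * mean N' Q powr 0 * measure M Q)"
        using N mean_pos[OF N Q] mean_pos[OF N' Q] mean_mult[OF Q, of N]
        by (simp add: admissible_def emeasure_eq_ennreal_measure less_top)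
    next
      have "r - 1 + 1 + (1 + t - 1) * (r - 1 - (p - 1) * l) = r + t * (r - 1) - t * (p - 1) * l"
        by (simp add: algebra_simps)
      also have "\<dots> = 0 + (p - 1) * (t * (1 - l))" unfolding t(3) by (simp add: algebra_simps)
      finally show "r - 1 + 1 + (1 + t - 1) * (r - 1 - (p - 1) * l) = 0 + (p - 1) * (t * (1 - l))" .
    qed (use N K l0 l1 l2 rpl t(2) F in \<open>auto simp: admissible_def\<close>)
    moreover have "mean N Q powr 0 * mean N' Q powr 1 * measure M Q = measure N' Q"
        "mean N' Q powr 1 = mean N' Q" if "Q \<in> F" for Q
      using that F mean_pos[OF N, of Q] mean_pos[OF N', of Q] mean_mult[of Q N'] by (auto simp: subset_eq)
    moreover have "(1 + t - 1) * l + t * (1 - l) = t" by (simp add: algebra_simps)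
    ultimately show "(\<integral>\<^sup>+x. ennreal (step_sum (\<lambda>Q. mean N Q powr (r - 1) * mean N' Q)
          F x powr (p / (p - r))) \<partial>N)
        \<le> ennreal (?C * K powr (r / (p - r)) * (\<Sum>Q\<in>F. measure N' Q))"
      unfolding t(1) t_def[symmetric] by (simp cong: sum.cong)
  qed
qed

section \<open>Extended powers\<close>

lemma epowr_ennreal: "0 < x \<Longrightarrow> epowr (ennreal x) a = ennreal (x powr a)"
  by (auto simp: epowr_def)

lemma epowr_ennreal_nonneg: "0 \<le> x \<Longrightarrow> 0 < a \<Longrightarrow> epowr (ennreal x) a = ennreal (x powr a)"
  by (cases "x = 0") (auto simp: epowr_def)

lemma epowr_mono:
  assumes "x \<le> y" "0 < a"
  shows "epowr x a \<le> epowr y a"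
proof (cases y)
  case (real v)
  with assms(1) obtain u where u: "x = ennreal u" "0 \<le> u" by (cases x) (auto simp: top_unique)
  with real assms have "u \<le> v" by simp
  then show ?thesis
    using u real assms by (auto simp: epowr_ennreal_nonneg intro!: ennreal_leI powr_mono2)
next
  case top
  then show ?thesis using assms by (simp add: epowr_def)
qed

lemma epowr_epowr_inverse: "0 < a \<Longrightarrow> epowr (epowr x a) (1 / a) = x"
proof (cases x)
  case (real u)
  assume "0 < a"
  with real show ?thesis by (simp add: epowr_ennreal_nonneg powr_powr)
next
  case top
  assume "0 < a"
  with top show ?thesis by (simp add: epowr_def)
qed

text \<open>Continuity from below holds because \<open>\<lambda>x. epowr x a\<close> is an order isomorphism, with inverse \<open>\<lambda>x. epowr x (1 / a)\<close>.\<close>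
lemma epowr_SUP:
  assumes "0 < a"
  shows "epowr (SUP n. f n) a = (SUP n. epowr (f n) a)"
proof (rule antisym)
  let ?b = "SUP n. epowr (f n) a"
  have "f n \<le> epowr ?b (1 / a)" for n
  proof -
    have "epowr (epowr (f n) a) (1 / a) \<le> epowr ?b (1 / a)"
      using assms by (intro epowr_mono SUP_upper) auto
    then show ?thesis using assms by (simp add: epowr_epowr_inverse)
  qed
  then have "epowr (SUP n. f n) a \<le> epowr (epowr ?b (1 / a)) a"
    using assms by (intro epowr_mono SUP_least) auto
  then show "epowr (SUP n. f n) a \<le> ?b"
    using epowr_epowr_inverse[of "1 / a" ?b] assms by simp
  show "?b \<le> epowr (SUP n. f n) a"
    using assms by (intro SUP_least epowr_mono SUP_upper) auto
qed

lemma epowr_eq_0_iff: "0 < a \<Longrightarrow> epowr x a = 0 \<longleftrightarrow> x = 0"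
  by (cases x) (auto simp: epowr_def)

lemma epowr_product_eq_top:
  assumes "0 < C" "0 < a" "0 < b" "x \<noteq> 0" "y \<noteq> 0" "x = \<infinity> \<or> y = \<infinity>"
  shows "ennreal C * epowr x a * epowr y b = \<infinity>"
proof -
  have "epowr \<infinity> c = \<infinity>" if "0 < c" for c using that by (simp add: epowr_def)
  then show ?thesis using assms by (auto simp: ennreal_mult_eq_top_iff epowr_eq_0_iff)
qed

lemma epowr_normalised_le:
  assumes "0 < C" "0 < K" "0 < L" "0 < s" "0 < e" "I \<le> ennreal (C * K * L * s)"
  shows "epowr (ennreal s) (- e) * epowr I e \<le> ennreal (C powr e) * ennreal (K powr e) * ennreal (L powr e)"
proof -
  have "epowr (ennreal s) (- e) * epowr I e \<le> ennreal (s powr (- e)) * ennreal ((C * K * L * s) powr e)"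
    using epowr_mono[OF assms(6,5)] assms by (simp add: epowr_ennreal mult_left_mono)
  also have "\<dots> = ennreal (s powr (- e) * (C * K * L * s) powr e)" by (simp add: ennreal_mult)
  also have "s powr (- e) * (C * K * L * s) powr e = C powr e * K powr e * L powr e"
    using assms by (simp add: powr_mult powr_minus)
  finally show ?thesis by (simp add: ennreal_mult)
qed

section \<open>Passing from finite subfamilies to countable families\<close>

lemma nn_integral_epowr_infsum_le:
  fixes a :: "'a::euclidean_space set \<Rightarrow> real" and w :: "'a \<Rightarrow> real"
  assumes A: "countable A" "A \<noteq> {}" "A \<subseteq> sets lebesgue" and a: "\<And>Q. Q \<in> A \<Longrightarrow> 0 \<le> a Q"
    and w: "w \<in> borel_measurable lebesgue" and q: "0 < q"
    and bound: "\<And>F. finite F \<Longrightarrow> F \<subseteq> A \<Longrightarrow>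
      (\<integral>\<^sup>+x. ennreal (step_sum a F x powr q) \<partial>density lebesgue (\<lambda>x. ennreal (w x))) \<le> B"
  shows "(\<integral>\<^sup>+x. epowr (\<Sum>\<^sub>\<infinity>Q\<in>A. ennreal (a Q) * indicator Q x) q * ennreal (w x) \<partial>lebesgue) \<le> B"
proof -
  define F where "F n = from_nat_into A ` {..<n}" for n :: nat
  have F: "finite (F n)" "F n \<subseteq> A" for n
    using from_nat_into[OF A(2)] by (auto simp: F_def)
  have F_mono: "F m \<subseteq> F n" if "m \<le> n" for m n using that by (auto simp: F_def)
  have exhaust: "\<exists>n. G \<subseteq> F n" if G: "finite G" "G \<subseteq> A" for G
  proof -
    have "G \<subseteq> from_nat_into A ` UNIV" using G A by (simp add: range_from_nat_into)
    then obtain I where I: "finite I" "G = from_nat_into A ` I"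
      using finite_subset_image[OF G(1), of "from_nat_into A" UNIV] by auto
    obtain n where "I \<subseteq> {..<n}" using I(1) finite_nat_iff_bounded by auto
    then show ?thesis using I by (auto simp: F_def)
  qed
  have fin: "(\<Sum>Q\<in>F n. ennreal (a Q) * indicator Q x) = ennreal (step_sum a (F n) x)" for n x
    using F a by (subst sum_ennreal[symmetric])
      (auto simp: ennreal_mult' ennreal_indicator subset_eq intro!: sum.cong mult_nonneg_nonneg)
  have S0: "0 \<le> step_sum a (F n) x" for n x
    using F a by (intro sum_nonneg mult_nonneg_nonneg) (auto simp: subset_eq)
  have S_mono: "step_sum a (F m) x \<le> step_sum a (F n) x" if "m \<le> n" for m n x
    using F_mono[OF that] F a by (intro sum_mono2) (auto simp: subset_eq)
  have total: "(\<Sum>\<^sub>\<infinity>Q\<in>A. ennreal (a Q) * indicator Q x) = (SUP n. ennreal (step_sum a (F n) x))" for x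
  proof -
    have "(\<Sum>\<^sub>\<infinity>Q\<in>A. ennreal (a Q) * indicator Q x)
        = (SUP G\<in>{G. finite G \<and> G \<subseteq> A}. \<Sum>Q\<in>G. ennreal (a Q) * indicator Q x)"
      by (rule nonneg_infsum_complete) simp
    also have "\<dots> = (SUP n. \<Sum>Q\<in>F n. ennreal (a Q) * indicator Q x)"
    proof (rule antisym)
      show "(SUP G\<in>{G. finite G \<and> G \<subseteq> A}. \<Sum>Q\<in>G. ennreal (a Q) * indicator Q x)
          \<le> (SUP n. \<Sum>Q\<in>F n. ennreal (a Q) * indicator Q x)"
      proof (rule SUP_mono)
        fix G assume "G \<in> {G. finite G \<and> G \<subseteq> A}"
        then have "finite G" "G \<subseteq> A" by auto
        then obtain n where "G \<subseteq> F n" using exhaust[of G] by blast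
        then show "\<exists>n\<in>UNIV. (\<Sum>Q\<in>G. ennreal (a Q) * indicator Q x)
            \<le> (\<Sum>Q\<in>F n. ennreal (a Q) * indicator Q x)"
          using F by (intro bexI[of _ n] sum_mono2) auto
      qed
      show "(SUP n. \<Sum>Q\<in>F n. ennreal (a Q) * indicator Q x)
          \<le> (SUP G\<in>{G. finite G \<and> G \<subseteq> A}. \<Sum>Q\<in>G. ennreal (a Q) * indicator Q x)"
        using F by (intro SUP_mono) auto
    qed
    finally show ?thesis by (simp add: fin)
  qed
  have meas [measurable]: "(\<lambda>x. ennreal (step_sum a (F n) x powr q)) \<in> borel_measurable lebesgue" for n
  proof -
    have [measurable]: "Q \<in> sets lebesgue" if "Q \<in> F n" for Q using that F A by auto
    show ?thesis by measurable
  qed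
  note w [measurable]
  have "(\<integral>\<^sup>+x. epowr (\<Sum>\<^sub>\<infinity>Q\<in>A. ennreal (a Q) * indicator Q x) q * ennreal (w x) \<partial>lebesgue)
      = (\<integral>\<^sup>+x. (SUP n. ennreal (step_sum a (F n) x powr q) * ennreal (w x)) \<partial>lebesgue)"
    using q S0 by (simp add: total epowr_SUP epowr_ennreal_nonneg SUP_mult_right_ennreal)
  also have "\<dots> = (SUP n. \<integral>\<^sup>+x. ennreal (step_sum a (F n) x powr q) * ennreal (w x) \<partial>lebesgue)"
    using q S0 S_mono
    by (intro nn_integral_monotone_convergence_SUP)
      (auto simp: incseq_def le_fun_def intro!: mult_right_mono ennreal_leI powr_mono2)
  also have "\<dots> = (SUP n. \<integral>\<^sup>+x. ennreal (step_sum a (F n) x powr q)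
      \<partial>density lebesgue (\<lambda>x. ennreal (w x)))"
  proof (intro SUP_cong refl)
    fix n
    show "(\<integral>\<^sup>+x. ennreal (step_sum a (F n) x powr q) * ennreal (w x) \<partial>lebesgue)
        = (\<integral>\<^sup>+x. ennreal (step_sum a (F n) x powr q) \<partial>density lebesgue (\<lambda>x. ennreal (w x)))"
      using meas[of n] w by (subst nn_integral_density) (auto simp: mult.commute)
  qed
  also have "\<dots> \<le> B" using F bound by (intro SUP_least) auto
  finally show ?thesis .
qed

section \<open>Dyadic cubes and weights\<close>

lemma half_open_cube_bounds:
  fixes a :: "real ^ 'n"
  shows "half_open_cube a l \<subseteq> cbox a (a + vec l)" "box a (a + vec l) \<subseteq> half_open_cube a l"
  by (auto simp: half_open_cube_def mem_box_cart less_imp_le)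

lemma half_open_cube_sets: "half_open_cube (a :: real ^ 'n) l \<in> sets lebesgue"
proof -
  have "half_open_cube a l = (\<Inter>i. {x. a $ i \<le> x $ i} \<inter> {x. x $ i < a $ i + l})"
    by (auto simp: half_open_cube_def)
  moreover have "\<dots> \<in> sets borel"
    by (intro sets.countable_INT' sets.Int borel_closed borel_open closed_Collect_le open_Collect_less
        continuous_intros) auto
  ultimately show ?thesis by (metis sets_completionI_sets sets_lborel)
qed

lemma half_open_cube_interior:
  assumes "0 < l"
  shows "box (a :: real ^ 'n) (a + vec l) \<noteq> {}" "interior (half_open_cube a l) \<noteq> {}"
proof -
  show ne: "box a (a + vec l) \<noteq> {}" using assms by (simp add: interval_ne_empty_cart)
  have "box a (a + vec l) \<subseteq> interior (half_open_cube a l)"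
    using half_open_cube_bounds(2) by (rule interior_maximal) auto
  with ne show "interior (half_open_cube a l) \<noteq> {}" by auto
qed

lemma half_open_cube_emeasure:
  assumes "0 < l"
  shows "0 < emeasure lebesgue (half_open_cube (a :: real ^ 'n) l)"
    "emeasure lebesgue (half_open_cube a l) < \<infinity>"
proof -
  have "emeasure lebesgue (box a (a + vec l)) \<le> emeasure lebesgue (half_open_cube a l)"
    by (intro emeasure_mono half_open_cube_bounds half_open_cube_sets)
  moreover have "0 < emeasure lebesgue (box a (a + vec l))"
    using half_open_cube_interior(1)[OF assms, of a] open_not_negligible[of "box a (a + vec l)"]
    by (auto simp: negligible_iff_emeasure0 zero_less_iff_neq_zero)
  ultimately show "0 < emeasure lebesgue (half_open_cube a l)" by simp
  have "emeasure lebesgue (half_open_cube a l) \<le> emeasure lebesgue (cbox a (a + vec l))"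
    by (intro emeasure_mono half_open_cube_bounds) auto
  also have "\<dots> < \<infinity>" using emeasure_lborel_cbox_finite[of a "a + vec l"] by simp
  finally show "emeasure lebesgue (half_open_cube a l) < \<infinity>" .
qed

lemma dyadic_systemE:
  fixes \<D> :: "(real ^ 'n) set set"
  assumes "dyadic_system \<D>" "Q \<in> \<D>"
  obtains a l where "0 < l" "Q = half_open_cube a l"
proof -
  obtain k and a where "Q = half_open_cube a (2 powi (- k))"
    using assms unfolding dyadic_system_def by (metis UN_iff)
  then show thesis by (intro that) auto
qed

lemma dyadic_system_nonempty:
  fixes \<D> :: "(real ^ 'n) set set"
  assumes "dyadic_system \<D>"
  shows "\<D> \<noteq> {}"
proof -
  obtain G :: "int \<Rightarrow> (real ^ 'n) set set" where "\<D> = (\<Union>k. G k)" "partition_on UNIV (G 0)"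
    using assms unfolding dyadic_system_def by metis
  then show ?thesis unfolding partition_on_def by blast
qed

lemma dyadic_system_nested:
  fixes \<D> :: "(real ^ 'n) set set"
  assumes "dyadic_system \<D>" "P \<in> \<D>" "Q \<in> \<D>"
  shows "P \<subseteq> Q \<or> Q \<subseteq> P \<or> P \<inter> Q = {}"
proof -
  obtain G :: "int \<Rightarrow> (real ^ 'n) set set" where G: "\<D> = (\<Union>k. G k)"
    "\<And>k. partition_on UNIV (G k)" "\<And>k Q. Q \<in> G (k + 1) \<Longrightarrow> \<exists>P\<in>G k. Q \<subseteq> P"
    using assms(1) unfolding dyadic_system_def by metis
  have ancestor: "\<exists>P\<in>G k. Q \<subseteq> P" if "Q \<in> G (k + int n)" for k n Q
    using that
  proof (induction n arbitrary: Q)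
    case (Suc n)
    then have "Q \<in> G (k + int n + 1)" by (simp add: ac_simps)
    then obtain P where "P \<in> G (k + int n)" "Q \<subseteq> P" using G(3) by blast
    with Suc.IH show ?case by (meson order_trans)
  qed auto
  have comparable: "Q \<subseteq> P \<or> P \<inter> Q = {}" if PQ: "P \<in> G k" "Q \<in> G l" "k \<le> l" for P Q k l
  proof -
    obtain P' where "P' \<in> G k" "Q \<subseteq> P'"
      using ancestor[of Q k "nat (l - k)"] PQ(2,3) by (simp split: if_splits) blast
    moreover from this(1) PQ(1) have "P = P' \<or> P \<inter> P' = {}"
      using partition_onD2[OF G(2)[of k]] by (auto simp: disjoint_def)
    ultimately show ?thesis by blast
  qed
  obtain k l where PQ: "P \<in> G k" "Q \<in> G l" using assms(2,3) G(1) by auto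
  show ?thesis
  proof (cases "k \<le> l")
    case True
    with comparable[OF PQ] show ?thesis by blast
  next
    case False
    with comparable[OF PQ(2,1)] show ?thesis by auto
  qed
qed

lemma dyadic_system_countable:
  assumes "dyadic_system (\<D> :: (real ^ 'n) set set)"
  shows "countable \<D>"
proof -
  obtain G :: "int \<Rightarrow> (real ^ 'n) set set" where G: "\<D> = (\<Union>k. G k)" "\<And>k. partition_on UNIV (G k)"
    using assms unfolding dyadic_system_def by metis
  have "countable (G k)" for k
  proof (rule countable_disjoint_nonempty_interior_subsets)
    show "pairwise disjnt (G k)" using G(2)[of k] by (simp add: partition_on_def)
    fix Q assume "Q \<in> G k" "interior Q = {}"
    moreover obtain a l where "0 < l" "Q = half_open_cube a l"
      using dyadic_systemE[OF assms] G(1) \<open>Q \<in> G k\<close> by blast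
    ultimately show "Q = {}" using half_open_cube_interior(2) by blast
  qed
  then show ?thesis using G(1) by auto
qed

lemma dyadic_cube_measure:
  fixes \<D> :: "(real ^ 'n) set set"
  assumes "dyadic_system \<D>" "Q \<in> \<D>"
  shows "Q \<in> sets lebesgue" "0 < emeasure lebesgue Q" "emeasure lebesgue Q < \<infinity>"
proof -
  obtain a l where "0 < l" "Q = half_open_cube a l" using dyadic_systemE[OF assms] .
  then show "Q \<in> sets lebesgue" "0 < emeasure lebesgue Q" "emeasure lebesgue Q < \<infinity>"
    using half_open_cube_sets half_open_cube_emeasure by auto
qed

lemma dyadic_cube_bounded:
  fixes \<D> :: "(real ^ 'n) set set"
  assumes "dyadic_system \<D>" "Q \<in> \<D>"
  obtains K where "compact K" "Q \<subseteq> K"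
proof -
  obtain a l where "Q = half_open_cube a l" using dyadic_systemE[OF assms] .
  then show thesis using that[OF compact_cbox] half_open_cube_bounds(1) by blast
qed

lemma weight_measurable:
  fixes w :: "real ^ 'n \<Rightarrow> real"
  assumes "weight w"
  shows "w \<in> borel_measurable lebesgue"
proof (rule borel_measurable_LIMSEQ_real)
  fix n :: nat
  show "(\<lambda>x. indicator (cball 0 (real n)) x *\<^sub>R w x) \<in> borel_measurable lebesgue"
    using assms unfolding weight_def set_integrable_def by (meson compact_cball borel_measurable_integrable)
next
  fix x :: "real ^ 'n"
  have "eventually (\<lambda>n. indicator (cball 0 (real n)) x *\<^sub>R w x = w x) sequentially"
    using eventually_ge_at_top[of "nat \<lceil>norm x\<rceil>"]
  proof eventually_elim
    case (elim n)
    then have "norm x \<le> real n" by linarith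
    then show ?case by simp
  qed
  then show "(\<lambda>n. indicator (cball 0 (real n)) x *\<^sub>R w x) \<longlonglongrightarrow> w x"
    by (rule tendsto_eventually)
qed

abbreviation weight_measure :: "(real ^ 'n \<Rightarrow> real) \<Rightarrow> (real ^ 'n) measure" where
  "weight_measure w \<equiv> density lebesgue (\<lambda>x. ennreal (w x))"

lemma emeasure_weight_measure:
  "weight w \<Longrightarrow> Q \<in> sets lebesgue \<Longrightarrow> emeasure (weight_measure w) Q = wmass w Q"
  using weight_measurable[of w] by (simp add: emeasure_density wmass_def)

lemma wmass_pos_finite:
  fixes \<D> :: "(real ^ 'n) set set"
  assumes w: "weight w" and D: "dyadic_system \<D>" "Q \<in> \<D>"
  shows "0 < wmass w Q" "wmass w Q < \<infinity>"
proof -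
  note [measurable] = weight_measurable[OF w] dyadic_cube_measure(1)[OF D]
  have "wmass w Q \<noteq> 0"
  proof
    assume "wmass w Q = 0"
    then have "AE x in lebesgue. ennreal (w x) * indicator Q x = 0"
      by (simp add: wmass_def nn_integral_0_iff_AE)
    moreover have "AE x in lebesgue. 0 < w x" using w by (simp add: weight_def)
    ultimately have "AE x in lebesgue. x \<notin> Q"
      by eventually_elim (auto simp: indicator_def split: if_splits)
    then have "emeasure lebesgue Q = 0"
      using dyadic_cube_measure(1)[OF D] by (simp add: AE_iff_measurable[OF _ refl])
    then show False using dyadic_cube_measure(2)[OF D] by simp
  qed
  then show "0 < wmass w Q" by (simp add: zero_less_iff_neq_zero)
  obtain K where K: "compact K" "Q \<subseteq> K" using dyadic_cube_bounded[OF D] .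
  have "wmass w Q \<le> (\<integral>\<^sup>+x. ennreal (norm (indicator K x *\<^sub>R w x)) \<partial>lebesgue)"
    unfolding wmass_def using K(2)
    by (intro nn_integral_mono) (auto simp: indicator_def intro!: ennreal_leI)
  also have "\<dots> < \<infinity>"
    using w K(1) unfolding weight_def set_integrable_def integrable_iff_bounded by blast
  finally show "wmass w Q < \<infinity>" .
qed

section \<open>The characteristics of a weight\<close>

lemma sparse_family_nested_sparse:
  fixes \<D> :: "(real ^ 'n) set set"
  assumes "dyadic_system \<D>" "sparse_family \<D> \<S>"
  obtains E where "nested_sparse lebesgue \<S> E"
proof -
  obtain E where S: "\<S> \<subseteq> \<D>" and E: "disjoint_family_on E \<S>"
    "\<And>Q. Q \<in> \<S> \<Longrightarrow> E Q \<in> sets lebesgue \<and> E Q \<subseteq> Q \<and> 1 / 2 * measure lebesgue Q \<le> measure lebesgue (E Q)"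
    using assms(2) unfolding sparse_family_def by blast
  have "nested_sparse lebesgue \<S> E"
  proof
    fix P Q assume "P \<in> \<S>" "Q \<in> \<S>"
    then show "P \<subseteq> Q \<or> Q \<subseteq> P \<or> P \<inter> Q = {}" using dyadic_system_nested[OF assms(1)] S by blast
  next
    fix Q assume Q: "Q \<in> \<S>"
    with S have "Q \<in> \<D>" by auto
    note Q_meas = dyadic_cube_measure[OF assms(1) this]
    then show "Q \<in> sets lebesgue" "0 < measure lebesgue Q" "emeasure lebesgue Q < \<infinity>"
      by (auto simp: measure_def enn2real_positive_iff)
    show "measure lebesgue Q \<le> 2 * measure lebesgue (E Q)" "E Q \<in> sets lebesgue" "E Q \<subseteq> Q"
      using E(2)[OF Q] by auto
  qed fact
  then show thesis by (rule that)
qed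

lemma weight_measure_admissible:
  assumes "dyadic_system \<D>" "\<S> \<subseteq> \<D>" "nested_sparse lebesgue \<S> E" "weight w"
  shows "nested_sparse.admissible lebesgue \<S> (weight_measure w)"
  unfolding nested_sparse.admissible_def[OF assms(3)]
proof (intro conjI ballI)
  fix Q assume "Q \<in> \<S>"
  then have "Q \<in> \<D>" using assms(2) by auto
  then show "0 < emeasure (weight_measure w) Q" "emeasure (weight_measure w) Q < \<infinity>"
    using wmass_pos_finite[OF assms(4,1)] emeasure_weight_measure[OF assms(4)]
      dyadic_cube_measure(1)[OF assms(1)] by auto
qed simp

lemma wmass_eq_measure:
  assumes "dyadic_system \<D>" "Q \<in> \<D>" "weight w"
  shows "wmass w Q = ennreal (measure (weight_measure w) Q)"
proof -
  have "emeasure (weight_measure w) Q = wmass w Q"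
    using assms dyadic_cube_measure(1) by (intro emeasure_weight_measure) auto
  then show ?thesis
    using wmass_pos_finite(2)[OF assms(3,1,2)] by (simp add: emeasure_eq_ennreal_measure[symmetric] less_top)
qed

lemma avg_eq_mean:
  assumes "dyadic_system \<D>" "Q \<in> \<D>" "weight w"
  shows "avg w Q = ennreal (measure (weight_measure w) Q / measure lebesgue Q)"
proof -
  have "avg w Q = wmass w Q / emeasure lebesgue Q" by (simp add: avg_def wmass_def)
  moreover have "emeasure lebesgue Q = ennreal (measure lebesgue Q)"
    using dyadic_cube_measure(3)[OF assms(1,2)] by (simp add: emeasure_eq_ennreal_measure less_top)
  moreover have "0 < measure lebesgue Q"
    using dyadic_cube_measure(2,3)[OF assms(1,2)] by (simp add: measure_def enn2real_positive_iff)
  ultimately show ?thesis by (simp add: wmass_eq_measure[OF assms] divide_ennreal)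
qed

lemma avg_pos:
  assumes "dyadic_system \<D>" "Q \<in> \<D>" "weight w"
  shows "0 < avg w Q" "avg w Q < \<infinity>"
proof -
  have "0 < measure (weight_measure w) Q"
    using wmass_pos_finite(1)[OF assms(3,1,2)] by (simp add: wmass_eq_measure[OF assms])
  moreover have "0 < measure lebesgue Q"
    using dyadic_cube_measure(2,3)[OF assms(1,2)] by (simp add: measure_def enn2real_positive_iff)
  ultimately show "0 < avg w Q" "avg w Q < \<infinity>" by (simp_all add: avg_eq_mean[OF assms])
qed

lemma Ap_char_nonzero:
  assumes "dyadic_system \<D>" "weight w" "weight \<sigma>"
  shows "Ap_char \<D> p w \<sigma> \<noteq> 0"
proof -
  obtain Q where Q: "Q \<in> \<D>" using dyadic_system_nonempty[OF assms(1)] by blast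
  note w = avg_pos[OF assms(1) Q assms(2)] and s = avg_pos[OF assms(1) Q assms(3)]
  have "epowr (avg \<sigma> Q) (p - 1) \<noteq> 0"
    using s by (cases "avg \<sigma> Q") (auto simp: epowr_ennreal epowr_def)
  then have "avg w Q * epowr (avg \<sigma> Q) (p - 1) \<noteq> 0" using w by simp
  moreover have "avg w Q * epowr (avg \<sigma> Q) (p - 1) \<le> Ap_char \<D> p w \<sigma>"
    unfolding Ap_char_def using Q by (intro SUP_upper)
  ultimately show ?thesis by auto
qed

lemma avg_le_dyadic_maximal:
  assumes "Q \<in> \<D>" "x \<in> Q" "Q \<subseteq> R"
  shows "avg w Q \<le> dyadic_maximal \<D> (\<lambda>y. indicator R y * w y) x"
proof -
  have "avg w Q \<le> avg (\<lambda>y. \<bar>indicator R y * w y\<bar>) Q"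
    unfolding avg_def using assms(3)
    by (intro divide_right_mono_ennreal nn_integral_mono)
      (auto simp: indicator_def intro!: ennreal_leI)
  also have "\<dots> = avg (\<lambda>y. \<bar>indicator R y * w y\<bar>) Q * indicator Q x" using assms(2) by simp
  also have "\<dots> \<le> dyadic_maximal \<D> (\<lambda>y. indicator R y * w y) x"
    unfolding dyadic_maximal_def using assms(1) by (rule SUP_upper)
  finally show ?thesis .
qed

lemma ennreal_divide_mult_self:
  fixes a b :: ennreal
  assumes "0 < b" "b < \<infinity>"
  shows "a / b * b = a"
  using assms ennreal_divide_self[of b] by (simp add: ennreal_divide_times)

text \<open>
  Together with the positivity of the \<open>A\<^sub>p\<close> characteristic, this excludes products \<open>0 * \<infinity>\<close> on the
  right-hand side when one of the characteristics is infinite.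
\<close>
lemma Ainf_char_ge_one:
  assumes "dyadic_system \<D>" "weight w"
  shows "1 \<le> Ainf_char \<D> w"
proof -
  obtain Q where Q: "Q \<in> \<D>" using dyadic_system_nonempty[OF assms(1)] by blast
  let ?I = "\<integral>\<^sup>+x\<in>Q. dyadic_maximal \<D> (\<lambda>y. indicator Q y * w y) x \<partial>lebesgue"
  note m = wmass_pos_finite[OF assms(2,1) Q] and c = dyadic_cube_measure[OF assms(1) Q]
  have "wmass w Q = avg w Q * emeasure lebesgue Q"
    using c by (simp add: avg_def wmass_def ennreal_divide_mult_self)
  also have "\<dots> = (\<integral>\<^sup>+x\<in>Q. avg w Q \<partial>lebesgue)" using c by (simp add: nn_integral_cmult_indicator)
  also have "\<dots> \<le> ?I"
    using avg_le_dyadic_maximal[OF Q _ order_refl] by (intro nn_integral_mono) (auto split: split_indicator)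
  finally have "wmass w Q / wmass w Q \<le> ?I / wmass w Q" by (rule divide_right_mono_ennreal)
  also have "\<dots> \<le> Ainf_char \<D> w" unfolding Ainf_char_def using Q by (intro SUP_upper)
  finally show ?thesis using m by simp
qed

text \<open>
  The mass of \<open>Q\<close> is at most twice the mean over \<open>Q\<close> integrated over \<open>E Q\<close>. There the mean is below
  the maximal function of \<open>w\<close> localised to \<open>R\<close>, and the sets \<open>E Q\<close> do not overlap.
\<close>
lemma sum_measure_le_Ainf_char:
  fixes \<D> :: "(real ^ 'n) set set"
  assumes D: "dyadic_system \<D>" "\<S> \<subseteq> \<D>" "nested_sparse lebesgue \<S> E" and w: "weight w"
    and L: "Ainf_char \<D> w = ennreal L" "0 \<le> L"
    and F: "finite F" "F \<subseteq> \<S>" "R \<in> \<S>" "\<And>Q. Q \<in> F \<Longrightarrow> Q \<subseteq> R"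
  shows "(\<Sum>Q\<in>F. measure (weight_measure w) Q) \<le> 2 * L * measure (weight_measure w) R"
proof -
  interpret nested_sparse lebesgue \<S> E by (rule D(3))
  let ?N = "weight_measure w"
  let ?I = "\<integral>\<^sup>+x\<in>R. dyadic_maximal \<D> (\<lambda>y. indicator R y * w y) x \<partial>lebesgue"
  have R: "R \<in> \<D>" using F D by auto
  have pw: "(\<Sum>Q\<in>F. avg w Q * indicator (E Q) x)
      \<le> dyadic_maximal \<D> (\<lambda>y. indicator R y * w y) x * indicator R x" for x
  proof (cases "\<exists>Q\<in>F. x \<in> E Q")
    case True
    then obtain Q where Q: "Q \<in> F" "x \<in> E Q" by auto
    then have "Q \<in> \<S>" "Q \<subseteq> R" using F(2,4) by auto
    with Q E_subset[of Q] have x: "x \<in> Q" "x \<in> R" by auto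
    have unique: "P = Q" if "P \<in> F" "x \<in> E P" for P
      using disjoint_family_onD[OF disjoint_E, of P Q] that Q F(2) by auto
    have "(\<Sum>P\<in>F. avg w P * indicator (E P) x) = (\<Sum>P\<in>{Q}. avg w P * indicator (E P) x)"
    proof (rule sum.mono_neutral_right)
      show "\<forall>P\<in>F - {Q}. avg w P * indicator (E P) x = 0" using unique by (auto split: split_indicator)
    qed (use Q F(1) in auto)
    also have "\<dots> = avg w Q" using Q by simp
    also have "\<dots> \<le> dyadic_maximal \<D> (\<lambda>y. indicator R y * w y) x"
      using Q x F D by (intro avg_le_dyadic_maximal) auto
    finally show ?thesis using x by simp
  next
    case False
    then have "(\<Sum>Q\<in>F. avg w Q * indicator (E Q) x) = 0" by (intro sum.neutral) auto
    then show ?thesis by simp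
  qed
  have "ennreal (\<Sum>Q\<in>F. measure ?N Q) = (\<Sum>Q\<in>F. ennreal (measure ?N Q))" by simp
  also have "\<dots> \<le> (\<Sum>Q\<in>F. 2 * (avg w Q * emeasure lebesgue (E Q)))"
  proof (rule sum_mono)
    fix Q assume "Q \<in> F"
    then have Q: "Q \<in> \<S>" "Q \<in> \<D>" using F D by auto
    have E: "emeasure lebesgue (E Q) = ennreal (measure lebesgue (E Q))"
      using fmeasurableI2[OF fmeasurable[OF Q(1)] E_subset[OF Q(1)] sets_E[OF Q(1)]]
      by (simp add: fmeasurable_def emeasure_eq_ennreal_measure less_top)
    have "measure ?N Q = mean ?N Q * measure lebesgue Q" using mean_mult[OF Q(1)] by simp
    also have "\<dots> \<le> mean ?N Q * (2 * measure lebesgue (E Q))"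
      using large_E[OF Q(1)] by (intro mult_left_mono) (auto simp: mean_def)
    finally have "ennreal (measure ?N Q) \<le> ennreal (2 * (mean ?N Q * measure lebesgue (E Q)))"
      by (intro ennreal_leI) simp
    also have "\<dots> = 2 * (ennreal (mean ?N Q) * ennreal (measure lebesgue (E Q)))"
    proof -
      have "0 \<le> mean ?N Q" by (simp add: mean_def)
      then show ?thesis by (simp add: ennreal_mult)
    qed
    finally show "ennreal (measure ?N Q) \<le> 2 * (avg w Q * emeasure lebesgue (E Q))"
      using avg_eq_mean[OF D(1) Q(2) w] by (simp add: E mean_def)
  qed
  also have "\<dots> = 2 * (\<Sum>Q\<in>F. avg w Q * emeasure lebesgue (E Q))" by (simp add: sum_distrib_left)
  also have "(\<Sum>Q\<in>F. avg w Q * emeasure lebesgue (E Q))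
      = (\<integral>\<^sup>+x. (\<Sum>Q\<in>F. avg w Q * indicator (E Q) x) \<partial>lebesgue)"
    using F sets_E by (subst nn_integral_sum) (auto simp: nn_integral_cmult_indicator subset_eq)
  also have "\<dots> \<le> ?I" by (intro nn_integral_mono pw)
  also have "?I = ?I / wmass w R * wmass w R"
    using wmass_pos_finite[OF w D(1) R] by (simp add: ennreal_divide_mult_self)
  also have "\<dots> \<le> Ainf_char \<D> w * wmass w R"
    unfolding Ainf_char_def using R by (intro mult_right_mono SUP_upper) auto
  also have "\<dots> = ennreal (L * measure ?N R)"
    using L by (simp add: wmass_eq_measure[OF D(1) R w] ennreal_mult)
  finally have "ennreal (\<Sum>Q\<in>F. measure ?N Q) \<le> ennreal (2 * (L * measure ?N R))"
    using L(2) by (simp add: ennreal_mult mult_left_mono)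
  then show ?thesis using L(2) by (subst (asm) ennreal_le_iff) auto
qed

section \<open>The testing constants\<close>

text \<open>
  Only finite subfamilies of the cubes below a fixed \<open>R\<close> have to be tested. Their bound is a sum of
  masses of cubes inside \<open>R\<close>, which the \<open>A\<^sub>\<infinity>\<close> packing estimate compares with the mass of \<open>R\<close>; the
  normalisation of the testing constant then cancels this mass. Both testing constants have this
  form, with the roles of \<open>u\<close> and \<open>v\<close> exchanged.
\<close>
lemma testing_sup_le:
  fixes \<D> :: "(real ^ 'n) set set"
  assumes D: "dyadic_system \<D>" "\<S> \<subseteq> \<D>" "nested_sparse lebesgue \<S> E"
    and v: "weight v" and u: "weight u" and q: "0 < q"
    and C: "0 < C" and K: "0 < K" and L: "Ainf_char \<D> u = ennreal L" "0 \<le> L"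
    and a: "\<And>Q. Q \<in> \<S> \<Longrightarrow> 0 \<le> a Q"
    and core: "\<And>F. finite F \<Longrightarrow> F \<subseteq> \<S> \<Longrightarrow>
      (\<integral>\<^sup>+x. ennreal (step_sum a F x powr q) \<partial>weight_measure v)
        \<le> ennreal (C * K * (\<Sum>Q\<in>F. measure (weight_measure u) Q))"
  shows "(SUP R\<in>\<S>. epowr (wmass u R) (- (1 / q)) *
      wnorm v q (\<lambda>x. \<Sum>\<^sub>\<infinity>Q\<in>{Q \<in> \<S>. Q \<subseteq> R}. ennreal (a Q) * indicator Q x))
    \<le> ennreal ((2 * C) powr (1 / q)) * ennreal (K powr (1 / q)) * ennreal (L powr (1 / q))"
proof (rule SUP_least)
  fix R assume R: "R \<in> \<S>"
  let ?A = "{Q \<in> \<S>. Q \<subseteq> R}" and ?s = "measure (weight_measure u) R"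
  have RD: "R \<in> \<D>" using R D by auto
  have L1: "1 \<le> L" using Ainf_char_ge_one[OF D(1) u] L by (simp add: ennreal_1[symmetric] del: ennreal_1)
  have s: "0 < ?s" using wmass_pos_finite(1)[OF u D(1) RD] by (simp add: wmass_eq_measure[OF D(1) RD u])
  have "(\<integral>\<^sup>+x. epowr (\<Sum>\<^sub>\<infinity>Q\<in>?A. ennreal (a Q) * indicator Q x) q * ennreal (v x) \<partial>lebesgue)
      \<le> ennreal (2 * C * K * L * ?s)"
  proof (rule nn_integral_epowr_infsum_le)
    show "countable ?A"
      using dyadic_system_countable[OF D(1)] D(2) by (auto intro: countable_subset)
    show "?A \<noteq> {}" using R by auto
    show "?A \<subseteq> sets lebesgue" using dyadic_cube_measure(1)[OF D(1)] D(2) by auto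
    show "v \<in> borel_measurable lebesgue" by (rule weight_measurable[OF v])
    fix F assume F: "finite F" "F \<subseteq> ?A"
    have "(\<integral>\<^sup>+x. ennreal (step_sum a F x powr q) \<partial>weight_measure v)
        \<le> ennreal (C * K * (\<Sum>Q\<in>F. measure (weight_measure u) Q))"
      using F by (intro core) auto
    also have "\<dots> \<le> ennreal (C * K * (2 * L * ?s))"
      using F R C K by (intro ennreal_leI mult_left_mono sum_measure_le_Ainf_char[OF D u L]) auto
    finally show "(\<integral>\<^sup>+x. ennreal (step_sum a F x powr q) \<partial>weight_measure v)
        \<le> ennreal (2 * C * K * L * ?s)" by (simp add: mult_ac)
  qed (use a q in auto)
  then have "epowr (ennreal ?s) (- (1 / q)) *
      wnorm v q (\<lambda>x. \<Sum>\<^sub>\<infinity>Q\<in>?A. ennreal (a Q) * indicator Q x)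
      \<le> ennreal ((2 * C) powr (1 / q)) * ennreal (K powr (1 / q)) * ennreal (L powr (1 / q))"
    unfolding wnorm_def using C K L1 s q by (intro epowr_normalised_le) auto
  then show "epowr (wmass u R) (- (1 / q)) *
      wnorm v q (\<lambda>x. \<Sum>\<^sub>\<infinity>Q\<in>?A. ennreal (a Q) * indicator Q x)
      \<le> ennreal ((2 * C) powr (1 / q)) * ennreal (K powr (1 / q)) * ennreal (L powr (1 / q))"
    by (simp add: wmass_eq_measure[OF D(1) RD u])
qed

lemma Ap_char_bound:
  assumes D: "dyadic_system \<D>" "\<S> \<subseteq> \<D>" "nested_sparse lebesgue \<S> E" and w: "weight w" "weight \<sigma>"
    and K: "Ap_char \<D> p w \<sigma> = ennreal K" "0 \<le> K" and Q: "Q \<in> \<S>"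
  shows "nested_sparse.mean lebesgue (weight_measure w) Q
      * nested_sparse.mean lebesgue (weight_measure \<sigma>) Q powr (p - 1) \<le> K"
proof -
  interpret nested_sparse lebesgue \<S> E by (rule D(3))
  have QD: "Q \<in> \<D>" using Q D by auto
  note avg = avg_eq_mean[OF D(1) QD w(1), folded mean_def] avg_eq_mean[OF D(1) QD w(2), folded mean_def]
  note m = mean_pos[OF weight_measure_admissible[OF D w(1)] Q] mean_pos[OF weight_measure_admissible[OF D w(2)] Q]
  have "avg w Q * epowr (avg \<sigma> Q) (p - 1) \<le> Ap_char \<D> p w \<sigma>"
    unfolding Ap_char_def using QD by (intro SUP_upper)
  then show ?thesis using m K by (simp add: avg epowr_ennreal ennreal_mult[symmetric])
qed

theorem proposition1p4:
  fixes \<D> :: "(real ^ 'n) set set" and r p :: real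
  assumes "dyadic_system \<D>" and "r > 0" and "1 < p"
  shows "\<exists>C::real. C > 0 \<and>
    (\<forall>(w :: real ^ 'n \<Rightarrow> real) (\<sigma> :: real ^ 'n \<Rightarrow> real) \<S>.
       weight w \<longrightarrow> weight \<sigma> \<longrightarrow> sparse_family \<D> \<S> \<longrightarrow>
         testing_T r p w \<sigma> \<S>
           \<le> ennreal C * epowr (Ap_char \<D> p w \<sigma>) (r / p) * epowr (Ainf_char \<D> \<sigma>) (r / p) \<and>
         (p > r \<longrightarrow>
           testing_T_dual r p w \<sigma> \<S>
             \<le> ennreal C * epowr (Ap_char \<D> p w \<sigma>) (r / p) * epowr (Ainf_char \<D> w) (1 - r / p)))"
proof -
  note D = assms(1) and r = assms(2) and p = assms(3)
  obtain C1 where C1: "0 < C1" and primal: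
    "\<And>(M :: (real ^ 'n) measure) \<S> E N N' F K. nested_sparse M \<S> E \<Longrightarrow> nested_sparse.admissible M \<S> N \<Longrightarrow>
      nested_sparse.admissible M \<S> N' \<Longrightarrow> finite F \<Longrightarrow> F \<subseteq> \<S> \<Longrightarrow>
      (\<And>Q. Q \<in> \<S> \<Longrightarrow> nested_sparse.mean M N' Q * nested_sparse.mean M N Q powr (p - 1) \<le> K) \<Longrightarrow>
      (\<integral>\<^sup>+x. ennreal (step_sum (\<lambda>Q. nested_sparse.mean M N Q powr r) F x powr (p / r)) \<partial>N')
        \<le> ennreal (C1 * K * (\<Sum>Q\<in>F. measure N Q))"
    by (rule testing_sum_le[OF r p, where ?'a = "real ^ 'n"]) blast
  obtain C2 where C2: "0 < C2" and dual:
    "\<And>(M :: (real ^ 'n) measure) \<S> E N N' F K. r < p \<Longrightarrow> nested_sparse M \<S> E \<Longrightarrow>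
      nested_sparse.admissible M \<S> N \<Longrightarrow>
      nested_sparse.admissible M \<S> N' \<Longrightarrow> finite F \<Longrightarrow> F \<subseteq> \<S> \<Longrightarrow>
      (\<And>Q. Q \<in> \<S> \<Longrightarrow> nested_sparse.mean M N' Q * nested_sparse.mean M N Q powr (p - 1) \<le> K) \<Longrightarrow>
      (\<integral>\<^sup>+x. ennreal (step_sum (\<lambda>Q. nested_sparse.mean M N Q powr (r - 1) * nested_sparse.mean M N' Q)
          F x powr (p / (p - r))) \<partial>N)
        \<le> ennreal (C2 * K powr (r / (p - r)) * (\<Sum>Q\<in>F. measure N' Q))"
  proof (cases "r < p")
    case True
    show thesis by (rule dual_testing_sum_le[OF r p True, where ?'a = "real ^ 'n"]) (rule that, blast+)
  next
    case False
    then show thesis using that[of 1] by auto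
  qed
  define B1 where "B1 = (2 * C1) powr (r / p)"
  define B2 where "B2 = (2 * C2) powr (1 - r / p)"
  have B: "0 < B1" "0 < B2" using C1 C2 by (auto simp: B1_def B2_def)
  have weaken: "X \<le> ennreal (B1 + B2) * k * l"
    if "X \<le> ennreal b * k * l" "b = B1 \<or> b = B2" for X k l b
  proof -
    have "ennreal b \<le> ennreal (B1 + B2)" using that(2) B by (intro ennreal_leI) auto
    then have "ennreal b * k * l \<le> ennreal (B1 + B2) * k * l" by (intro mult_right_mono) auto
    with that(1) show ?thesis by (rule order_trans)
  qed
  show ?thesis
  proof (intro exI[of _ "B1 + B2"] conjI allI impI)
    show "0 < B1 + B2" using B by simp
  next
    fix w \<sigma> :: "real ^ 'n \<Rightarrow> real" and \<S>
    assume w: "weight w" and \<sigma>: "weight \<sigma>" and S: "sparse_family \<D> \<S>"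
    have SD: "\<S> \<subseteq> \<D>" using S by (simp add: sparse_family_def)
    obtain E where E: "nested_sparse lebesgue \<S> E" using sparse_family_nested_sparse[OF D S] .
    interpret nested_sparse lebesgue \<S> E by (rule E)
    note adm = weight_measure_admissible[OF D SD E]
    let ?Ap = "Ap_char \<D> p w \<sigma>" and ?X = "mean (weight_measure \<sigma>)" and ?Y = "mean (weight_measure w)"
    have avg: "avg \<sigma> Q = ennreal (?X Q)" "avg w Q = ennreal (?Y Q)" if "Q \<in> \<S>" for Q
      using avg_eq_mean[OF D _ \<sigma>] avg_eq_mean[OF D _ w] that SD by (auto simp: mean_def)
    have Xpos: "0 < ?X Q" "0 < ?Y Q" if "Q \<in> \<S>" for Q
      using that mean_pos[OF adm[OF \<sigma>]] mean_pos[OF adm[OF w]] by auto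
    have Ap0: "?Ap \<noteq> 0" by (rule Ap_char_nonzero[OF D w \<sigma>])
    have Ainf0: "Ainf_char \<D> \<sigma> \<noteq> 0" "Ainf_char \<D> w \<noteq> 0"
      using Ainf_char_ge_one[OF D \<sigma>] Ainf_char_ge_one[OF D w] by auto
    show "testing_T r p w \<sigma> \<S>
        \<le> ennreal (B1 + B2) * epowr ?Ap (r / p) * epowr (Ainf_char \<D> \<sigma>) (r / p)"
    proof (cases "?Ap = \<infinity> \<or> Ainf_char \<D> \<sigma> = \<infinity>")
      case True
      then show ?thesis
        using epowr_product_eq_top[of "B1 + B2" "r / p" "r / p" ?Ap "Ainf_char \<D> \<sigma>"] B r p Ap0 Ainf0
        by simp
    next
      case False
      obtain K where K: "?Ap = ennreal K" "0 < K"
        using False Ap0 by (cases ?Ap) (auto simp: less_le)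
      obtain L where L: "Ainf_char \<D> \<sigma> = ennreal L" "0 < L"
        using False Ainf0 by (cases "Ainf_char \<D> \<sigma>") (auto simp: less_le)
      have "testing_T r p w \<sigma> \<S> = (SUP R\<in>\<S>. epowr (wmass \<sigma> R) (- (1 / (p / r))) *
          wnorm w (p / r) (\<lambda>x. \<Sum>\<^sub>\<infinity>Q\<in>{Q \<in> \<S>. Q \<subseteq> R}. ennreal (?X Q powr r) * indicator Q x))"
        unfolding testing_T_def using Xpos
        by (intro SUP_cong refl arg_cong2[where f = "(*)"] arg_cong2[where f = epowr]
            arg_cong[where f = "wnorm w (p / r)"] ext infsum_cong) (auto simp: avg epowr_ennreal)
      also have "\<dots> \<le> ennreal ((2 * C1) powr (1 / (p / r))) * ennreal (K powr (1 / (p / r)))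
          * ennreal (L powr (1 / (p / r)))"
      proof (rule testing_sup_le[OF D SD E w \<sigma> _ C1 K(2) L(1)])
        fix F assume F: "finite F" "F \<subseteq> \<S>"
        show "(\<integral>\<^sup>+x. ennreal (step_sum (\<lambda>Q. ?X Q powr r) F x powr (p / r)) \<partial>weight_measure w)
            \<le> ennreal (C1 * K * (\<Sum>Q\<in>F. measure (weight_measure \<sigma>) Q))"
          using K(2) by (intro primal[OF E adm[OF \<sigma>] adm[OF w] F] Ap_char_bound[OF D SD E w \<sigma> K(1)]) auto
      qed (use r p L in auto)
      also have "\<dots> = ennreal B1 * epowr ?Ap (r / p) * epowr (Ainf_char \<D> \<sigma>) (r / p)"
        using K L by (simp add: B1_def epowr_ennreal)
      finally show ?thesis by (rule weaken) simp
    qed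
    assume rp: "r < p"
    define e where "e = 1 - r / p"
    have e: "0 < e" "1 / (p / (p - r)) = e" "r / (p - r) * e = r / p"
      using rp r p by (auto simp: e_def field_simps)
    show "testing_T_dual r p w \<sigma> \<S>
        \<le> ennreal (B1 + B2) * epowr ?Ap (r / p) * epowr (Ainf_char \<D> w) (1 - r / p)"
    proof (cases "?Ap = \<infinity> \<or> Ainf_char \<D> w = \<infinity>")
      case True
      then show ?thesis
        using epowr_product_eq_top[of "B1 + B2" "r / p" e ?Ap "Ainf_char \<D> w"] B r p e Ap0 Ainf0
        by (simp add: e_def)
    next
      case False
      obtain K where K: "?Ap = ennreal K" "0 < K"
        using False Ap0 by (cases ?Ap) (auto simp: less_le)
      obtain L where L: "Ainf_char \<D> w = ennreal L" "0 < L"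
        using False Ainf0 by (cases "Ainf_char \<D> w") (auto simp: less_le)
      let ?K = "K powr (r / (p - r))"
      have "testing_T_dual r p w \<sigma> \<S> = (SUP R\<in>\<S>. epowr (wmass w R) (- (1 / (p / (p - r)))) *
          wnorm \<sigma> (p / (p - r))
            (\<lambda>x. \<Sum>\<^sub>\<infinity>Q\<in>{Q \<in> \<S>. Q \<subseteq> R}. ennreal (?X Q powr (r - 1) * ?Y Q) * indicator Q x))"
        unfolding testing_T_dual_def using Xpos
        by (intro SUP_cong refl arg_cong2[where f = "(*)"] arg_cong2[where f = epowr]
            arg_cong[where f = "wnorm \<sigma> (p / (p - r))"] ext infsum_cong)
          (auto simp: avg epowr_ennreal ennreal_mult less_imp_le)
      also have "\<dots> \<le> ennreal ((2 * C2) powr (1 / (p / (p - r)))) * ennreal (?K powr (1 / (p / (p - r))))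
          * ennreal (L powr (1 / (p / (p - r))))"
      proof (rule testing_sup_le[OF D SD E \<sigma> w _ C2 _ L(1)])
        fix F assume F: "finite F" "F \<subseteq> \<S>"
        show "(\<integral>\<^sup>+x. ennreal (step_sum (\<lambda>Q. ?X Q powr (r - 1) * ?Y Q) F x powr (p / (p - r)))
            \<partial>weight_measure \<sigma>)
            \<le> ennreal (C2 * ?K * (\<Sum>Q\<in>F. measure (weight_measure w) Q))"
          using K(2) by (intro dual[OF rp E adm[OF \<sigma>] adm[OF w] F] Ap_char_bound[OF D SD E w \<sigma> K(1)]) auto
      next
        fix Q assume "Q \<in> \<S>"
        then show "0 \<le> ?X Q powr (r - 1) * ?Y Q" using Xpos by (simp add: less_imp_le)
      qed (use r rp p L K in auto)
      also have "\<dots> = ennreal B2 * epowr ?Ap (r / p) * epowr (Ainf_char \<D> w) (1 - r / p)"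
        unfolding e(2) powr_powr e(3) using K L by (simp add: B2_def e_def epowr_ennreal)
      finally show ?thesis by (rule weaken) simp
    qed
  qed
qed

end
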